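(* For every integer $n \ge 2$ there is a constant $C(n)$, depending only on $n$, such that the following holds. Let $A \ge 1$ be an integer and let $T_{j,a} \subset \mathbb{R}^n$, $1 \le j \le n$, $1 \le a \le A$, be cylinders of radius $1$ such that for every $j$ and $a$ the angle between the core of $T_{j,a}$ and the $x_j$-axis is at most $(100n)^{-1}$. Let $$I := \bigcap_{j=1}^n \left[ \bigcup_{a=1}^A T_{j,a} \right]$$ be the set of points that belong to at least one cylinder of each of the $n$ classes. Then $$\mathrm{Vol}(I) \le C(n)\, A^{\frac{n}{n-1}}.$$
   Context: A cylinder of radius $R$ around a (bi-infinite) line $L \subset \mathbb{R}^n$ is the set of all points $x \in \mathbb{R}^n$ within distance $R$ of $L$. The line $L$ is called the core of the cylinder. $\mathrm{Vol}$ denotes $n$-dimensional Lebesgue measure. The angle between two lines is the angle in $[0,\pi/2]$ between their directions. *)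

theory Defs
  imports "HOL-Analysis.Analysis"
begin

definition line :: "'a::real_vector \<Rightarrow> 'a \<Rightarrow> 'a set" where
  "line p u = range (\<lambda>t. p + t *\<^sub>R u)"

definition line_direction :: "'a::real_vector set \<Rightarrow> 'a \<Rightarrow> bool" where
  "line_direction L u \<longleftrightarrow> u \<noteq> 0 \<and> (\<exists>p. L = line p u)"

definition is_line :: "'a::real_vector set \<Rightarrow> bool" where
  "is_line L \<longleftrightarrow> (\<exists>u. line_direction L u)"

definition cylinder :: "real \<Rightarrow> 'a::metric_space set \<Rightarrow> 'a set" where
  "cylinder R L = {x. infdist x L \<le> R}"

(* The absolute value selects the angle in [0, pi/2] and makes it independent of
   the chosen direction vectors; see line_angle_line below. *)
definition line_angle :: "'a::real_inner set \<Rightarrow> 'a set \<Rightarrow> real" where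
  "line_angle L M = (THE \<theta>. \<exists>u v. line_direction L u \<and> line_direction M v \<and>
     \<theta> = arccos (\<bar>u \<bullet> v\<bar> / (norm u * norm v)))"

definition coord_axis :: "'n::finite \<Rightarrow> (real ^ 'n) set" where
  "coord_axis j = line 0 (axis j 1)"

lemma line_direction_parallel:
  assumes "line_direction L u" "line_direction L v"
  obtains c where "c \<noteq> 0" "v = c *\<^sub>R u"
proof -
  obtain p q where p: "L = line p u" and q: "L = line q v" and "v \<noteq> 0"
    using assms by (auto simp: line_direction_def)
  have "q + 0 *\<^sub>R v \<in> L" "q + 1 *\<^sub>R v \<in> L"
    unfolding q line_def by blast+
  then obtain s t where "q + 0 *\<^sub>R v = p + s *\<^sub>R u" "q + 1 *\<^sub>R v = p + t *\<^sub>R u"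
    unfolding p line_def by blast
  then have "v = (t - s) *\<^sub>R u"
    by (simp add: algebra_simps)
  with \<open>v \<noteq> 0\<close> show ?thesis
    by (intro that[of "t - s"]) auto
qed

lemma line_angle_eq:
  assumes "line_direction L u" "line_direction M v"
  shows "line_angle L M = arccos (\<bar>u \<bullet> v\<bar> / (norm u * norm v))"
  unfolding line_angle_def
proof (rule the_equality)
  fix \<theta>
  assume "\<exists>u v. line_direction L u \<and> line_direction M v \<and>
    \<theta> = arccos (\<bar>u \<bullet> v\<bar> / (norm u * norm v))"
  then obtain u' v' where uv: "line_direction L u'" "line_direction M v'"
    and \<theta>: "\<theta> = arccos (\<bar>u' \<bullet> v'\<bar> / (norm u' * norm v'))"
    by blast
  obtain c d where "c \<noteq> 0" "u' = c *\<^sub>R u" "d \<noteq> 0" "v' = d *\<^sub>R v"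
    using line_direction_parallel[OF assms(1) uv(1)] line_direction_parallel[OF assms(2) uv(2)]
    by metis
  then show "\<theta> = arccos (\<bar>u \<bullet> v\<bar> / (norm u * norm v))"
    unfolding \<theta> by (simp add: abs_mult)
qed (use assms in blast)

lemma line_angle_line:
  assumes "u \<noteq> 0" "v \<noteq> 0"
  shows "line_angle (line p u) (line q v) = arccos (\<bar>u \<bullet> v\<bar> / (norm u * norm v))"
  using assms by (intro line_angle_eq) (auto simp: line_direction_def)

lemma closed_cylinder: "closed (cylinder R L)"
  unfolding cylinder_def by (intro closed_Collect_le continuous_intros)

end

theory Submission
  imports Defs "HOL-Library.Z2"
begin

text \<open>
  This is Guth's polynomial argument with his directed volumes replaced by measures of sets of points
  near which a polynomial changes sign. Let \<open>F\<close> be a maximal separated set of \<open>V\<close> points of the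
  intersection. By the ham sandwich theorem some polynomial \<open>P\<close> of degree \<open>O(V powr (1 / n))\<close> bisects the
  unit ball around each point of \<open>F\<close>. In a bisected ball, a fixed proportion of the points \<open>x\<close>
  and some bounded vector \<open>h\<close> satisfy \<open>P x > 0 \<ge> P (x + h)\<close>; walking from \<open>x\<close> to \<open>x + h\<close> along the
  directions of the \<open>n\<close> tubes through the centre, one of the directions accounts for a fixed proportion of the
  sign changes. Translating the balls assigned to one tube along its core into a single bounded
  region covers each point at most \<open>deg P\<close> times, because \<open>P\<close> has at most \<open>deg P\<close> zeros on a line. Summing
  over the \<open>n A\<close> tubes gives \<open>V \<le> C A V powr (1 / n)\<close>.

  The ham sandwich theorem needs the Borsuk-Ulam theorem in all dimensions. If odd functions
  \<open>F 0, \<dots>, F (n - 1)\<close> had no common zero on the \<open>n\<close>-sphere, the cup product of the mod 2 coboundaries of their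
  sign cochains would vanish on every sufficiently small simplex, since some \<open>F j\<close> has constant sign there;
  but it evaluates to \<open>1\<close> on a subdivided hemisphere, by induction over the hemispheres of lower dimension.
\<close>

section \<open>Mod 2 cochains on ordered simplices\<close>

declare add_bit_eq_xor [simp del] mult_bit_eq_and [simp del]

lemma bit_add_self: "a + a = (0::bit)"
  by (cases a) simp_all

lemma bit_add_self_left: "a + (a + b) = (b::bit)"
  by (cases a; cases b) simp_all

text \<open>A simplex is the list of its vertices, and chains are handled through their pairings with functionals;
  \<open>cob \<phi> s\<close> is the value of \<open>\<phi>\<close> on the mod 2 boundary of \<open>s\<close>. The empty list is the simplex of
  dimension \<open>-1\<close>.\<close>

fun cob :: "('a list \<Rightarrow> bit) \<Rightarrow> 'a list \<Rightarrow> bit" where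
  "cob \<phi> [] = 0"
| "cob \<phi> (x # s) = \<phi> s + cob (\<lambda>t. \<phi> (x # t)) s"

lemma cob_cong:
  assumes "\<And>t. Suc (length t) = length s \<Longrightarrow> set t \<subseteq> set s \<Longrightarrow> \<phi> t = \<psi> t"
  shows "cob \<phi> s = cob \<psi> s"
  using assms
proof (induction s arbitrary: \<phi> \<psi>)
  case (Cons x s)
  have "cob (\<lambda>t. \<phi> (x # t)) s = cob (\<lambda>t. \<psi> (x # t)) s"
    by (rule Cons.IH) (rule Cons.prems, auto)
  moreover have "\<phi> s = \<psi> s"
    by (rule Cons.prems) auto
  ultimately show ?case
    by simp
qed simp

lemma cob_0: "cob (\<lambda>t. 0) s = 0"
  by (induction s) simp_all

lemma cob_add: "cob (\<lambda>t. \<phi> t + \<psi> t) s = cob \<phi> s + cob \<psi> s"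
  by (induction s arbitrary: \<phi> \<psi>) (simp_all add: ac_simps)

text \<open>Deleting two entries in either order produces every remaining list twice, and the two
  cancel mod 2.\<close>

lemma cob_cob: "cob (cob \<phi>) s = 0"
  by (induction s arbitrary: \<phi>) (simp_all add: cob_add bit_add_self_left)

lemma cob_map: "cob (\<lambda>t. \<phi> (map f t)) s = cob \<phi> (map f s)"
proof (induction s arbitrary: \<phi>)
  case (Cons x s)
  show ?case
    using Cons.IH[of "\<lambda>t. \<phi> (f x # t)"] by simp
qed simp

section \<open>Barycentric subdivision acting on cochains\<close>

definition barycenter :: "'a::real_vector list \<Rightarrow> 'a" where
  "barycenter s = (1 / real (length s)) *\<^sub>R sum_list s"

text \<open>The value of \<open>\<phi>\<close> on the barycentric subdivision of an ordered simplex with \<open>k\<close> vertices.\<close>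

primrec subdiv :: "nat \<Rightarrow> ('a::real_vector list \<Rightarrow> bit) \<Rightarrow> 'a list \<Rightarrow> bit" where
  "subdiv 0 \<phi> s = \<phi> s"
| "subdiv (Suc k) \<phi> s = cob (subdiv k (\<lambda>t. \<phi> (barycenter s # t))) s"

lemma subdiv_0:
  fixes s :: "'a::real_vector list"
  shows "subdiv k (\<lambda>t. 0) s = 0"
proof (induction k arbitrary: s)
  case (Suc k)
  then have "subdiv k (\<lambda>t. 0) = (\<lambda>t :: 'a list. 0)"
    by (simp add: fun_eq_iff)
  then show ?case
    by (simp add: cob_0)
qed simp

lemma subdiv_add: "subdiv k (\<lambda>t. \<phi> t + \<psi> t) s = subdiv k \<phi> s + subdiv k \<psi> s"
proof (induction k arbitrary: \<phi> \<psi> s)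
  case (Suc k)
  show ?case
    unfolding subdiv.simps Suc.IH[abs_def] cob_add ..
qed simp

text \<open>On a cone with apex the barycenter, \<open>cob \<phi>\<close> splits into
  \<open>\<phi>\<close> on the base and the coboundary of \<open>\<psi>\<close> on the base. By
  induction the second part contributes a double coboundary, which is 0.\<close>

lemma subdiv_cob:
  "length s = Suc k \<Longrightarrow> subdiv (Suc k) (cob \<phi>) s = cob (subdiv k \<phi>) s"
proof (induction k arbitrary: \<phi> s)
  case 0
  then show ?case
    by (auto simp: length_Suc_conv)
next
  case (Suc k)
  define \<psi> where "\<psi> = (\<lambda>t. \<phi> (barycenter s # t))"
  have "subdiv (Suc (Suc k)) (cob \<phi>) s
      = cob (subdiv (Suc k) (\<lambda>t. \<phi> t + cob \<psi> t)) s"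
    by (simp only: subdiv.simps(2)[of "Suc k"] cob.simps \<psi>_def)
  also have "\<dots> = cob (subdiv (Suc k) \<phi>) s + cob (subdiv (Suc k) (cob \<psi>)) s"
    unfolding subdiv_add[abs_def] cob_add ..
  also have "cob (subdiv (Suc k) (cob \<psi>)) s = cob (cob (subdiv k \<psi>)) s"
    by (rule cob_cong) (use Suc in auto)
  finally show ?case
    by (simp only: cob_cob add_0_right)
qed

lemma barycenter_uminus: "barycenter (map uminus s) = - barycenter s"
proof -
  have "sum_list (map uminus s) = - sum_list s"
    by (induction s) simp_all
  then show ?thesis
    by (simp add: barycenter_def)
qed

lemma subdiv_uminus: "subdiv k (\<lambda>t. \<phi> (map uminus t)) s = subdiv k \<phi> (map uminus s)"
proof (induction k arbitrary: \<phi> s)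
  case (Suc k)
  have "subdiv (Suc k) (\<lambda>t. \<phi> (map uminus t)) s
      = cob (\<lambda>t. subdiv k (\<lambda>t. \<phi> (- barycenter s # t)) (map uminus t)) s"
    using Suc.IH[of "\<lambda>t. \<phi> (- barycenter s # t)"] by (simp add: fun_eq_iff cong: cob_cong)
  then show ?case
    by (simp add: cob_map barycenter_uminus)
qed simp

lemma barycenter_in_hull:
  assumes "s \<noteq> []"
  shows "barycenter s \<in> convex hull set s"
proof -
  have "(\<Sum>i<length s. (1 / real (length s)) *\<^sub>R s ! i) \<in> convex hull set s"
    using assms by (intro convex_sum) (auto intro: hull_inc)
  then show ?thesis
    by (simp add: barycenter_def sum_list_sum_nth atLeast0LessThan scaleR_sum_right)
qed

text \<open>The barycenter minus \<open>v\<close> is the mean of \<open>Suc k\<close> differences,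
  and the difference of \<open>v\<close> with itself is 0; hence the factor
  \<open>k / Suc k\<close>.\<close>

lemma dist_barycenter_vertex:
  fixes s :: "'a::real_normed_vector list"
  assumes "length s = Suc k" "v \<in> set s"
    and d: "\<And>x y. x \<in> set s \<Longrightarrow> y \<in> set s \<Longrightarrow> dist x y \<le> d"
  shows "dist (barycenter s) v \<le> real k / real (Suc k) * d"
proof -
  obtain xs ys where s: "s = xs @ v # ys"
    using assms(2) by (meson split_list)
  have k: "k = length (xs @ ys)"
    using assms(1) s by simp
  have *: "norm (sum_list zs - real (length zs) *\<^sub>R v) \<le> real (length zs) * d" if "set zs \<subseteq> set s" for zs
    using that
  proof (induction zs)
    case (Cons z zs)
    have "norm (sum_list (z # zs) - real (length (z # zs)) *\<^sub>R v)
        = norm ((z - v) + (sum_list zs - real (length zs) *\<^sub>R v))"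
      by (simp add: algebra_simps)
    also have "\<dots> \<le> norm (z - v) + norm (sum_list zs - real (length zs) *\<^sub>R v)"
      by (rule norm_triangle_ineq)
    also have "\<dots> \<le> d + real (length zs) * d"
      using Cons d[of z v] assms(2) by (intro add_mono) (auto simp: dist_norm)
    finally show ?case
      by (simp add: algebra_simps)
  qed simp
  have "barycenter s - v = (1 / real (Suc k)) *\<^sub>R (sum_list s - real (Suc k) *\<^sub>R v)"
    using assms(1) by (simp add: barycenter_def scaleR_diff_right del: of_nat_Suc)
  also have "sum_list s - real (Suc k) *\<^sub>R v = sum_list (xs @ ys) - real k *\<^sub>R v"
    by (simp add: s algebra_simps)
  finally have "dist (barycenter s) v = (1 / real (Suc k)) * norm (sum_list (xs @ ys) - real k *\<^sub>R v)"
    by (simp only: dist_norm norm_scaleR) simp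
  also have "\<dots> \<le> (1 / real (Suc k)) * (real k * d)"
    using *[of "xs @ ys"] s k by (intro mult_left_mono) auto
  finally show ?thesis
    by simp
qed

text \<open>This is the mesh estimate in the form used later: only the small simplices of the
  subdivision matter. Edges at the barycenter are bounded by \<open>dist_barycenter_vertex\<close>;
  the other edges come from subdividing a face, where the factor is smaller.\<close>

lemma subdiv_cong:
  fixes s :: "'a::real_normed_vector list"
  assumes "length s = k"
    and "\<And>x y. x \<in> set s \<Longrightarrow> y \<in> set s \<Longrightarrow> dist x y \<le> d"
    and "\<And>t. length t = k \<Longrightarrow> set t \<subseteq> convex hull set s \<Longrightarrow>
      (\<And>x y. x \<in> set t \<Longrightarrow> y \<in> set t \<Longrightarrow> dist x y \<le> (real k - 1) / real k * d) \<Longrightarrow> \<phi> t = \<psi> t"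
  shows "subdiv k \<phi> s = subdiv k \<psi> s"
  using assms
proof (induction k arbitrary: \<phi> \<psi> s)
  case 0
  then show ?case
    by simp
next
  case (Suc k)
  define b where "b = barycenter s"
  have "s \<noteq> []"
    using Suc.prems(1) by auto
  then have "0 \<le> d"
    using Suc.prems(2)[of "hd s" "hd s"] by simp
  have b: "b \<in> convex hull set s"
    unfolding b_def using \<open>s \<noteq> []\<close> by (rule barycenter_in_hull)
  have ball: "convex hull set s \<subseteq> cball b (real k / real (Suc k) * d)"
    unfolding b_def using dist_barycenter_vertex[OF Suc.prems(1) _ Suc.prems(2)]
    by (intro hull_minimal) auto
  have "subdiv k (\<lambda>t. \<phi> (b # t)) u = subdiv k (\<lambda>t. \<psi> (b # t)) u"
    if u: "Suc (length u) = length s" "set u \<subseteq> set s" for u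
  proof (rule Suc.IH)
    show "length u = k"
      using u Suc.prems(1) by simp
    show "dist x y \<le> d" if "x \<in> set u" "y \<in> set u" for x y
      using that u Suc.prems(2) by auto
    fix t assume t: "length t = k" "set t \<subseteq> convex hull set u"
      "\<And>x y. x \<in> set t \<Longrightarrow> y \<in> set t \<Longrightarrow> dist x y \<le> (real k - 1) / real k * d"
    have hull: "set t \<subseteq> convex hull set s"
      using t(2) hull_mono[OF u(2)] by blast
    show "\<phi> (b # t) = \<psi> (b # t)"
    proof (rule Suc.prems(3))
      show "length (b # t) = Suc k" "set (b # t) \<subseteq> convex hull set s"
        using t(1) hull b by auto
      fix x y assume xy: "x \<in> set (b # t)" "y \<in> set (b # t)"
      have bt: "dist b z \<le> real k / real (Suc k) * d" if "z \<in> set t" for z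
        using that hull ball by auto
      have "(real k - 1) / real k \<le> real k / real (Suc k)"
        by (cases "k = 0") (auto simp: field_simps)
      then have "(real k - 1) / real k * d \<le> real k / real (Suc k) * d"
        using \<open>0 \<le> d\<close> by (rule mult_right_mono)
      then have tt: "dist z w \<le> real k / real (Suc k) * d" if "z \<in> set t" "w \<in> set t" for z w
        using t(3)[OF that] by linarith
      have "dist x y \<le> real k / real (Suc k) * d"
        using xy bt[of x] bt[of y] tt[of x y] \<open>0 \<le> d\<close> by (auto simp: dist_commute)
      then show "dist x y \<le> (real (Suc k) - 1) / real (Suc k) * d"
        by simp
    qed
  qed
  then show ?case
    unfolding subdiv.simps b_def[symmetric] by (intro cob_cong) auto
qed

abbreviation "subdivs m k \<equiv> subdiv k ^^ m"

lemma subdivs_cong: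
  fixes s :: "'a::real_normed_vector list"
  assumes "length s = k"
    and "\<And>x y. x \<in> set s \<Longrightarrow> y \<in> set s \<Longrightarrow> dist x y \<le> d"
    and "\<And>t. length t = k \<Longrightarrow> set t \<subseteq> convex hull set s \<Longrightarrow>
      (\<And>x y. x \<in> set t \<Longrightarrow> y \<in> set t \<Longrightarrow> dist x y \<le> ((real k - 1) / real k) ^ m * d) \<Longrightarrow> \<phi> t = \<psi> t"
  shows "subdivs m k \<phi> s = subdivs m k \<psi> s"
  using assms
proof (induction m arbitrary: s d)
  case 0
  then show ?case
    by (simp add: hull_subset)
next
  case (Suc m)
  have "subdiv k (subdivs m k \<phi>) s = subdiv k (subdivs m k \<psi>) s"
  proof (rule subdiv_cong[OF Suc.prems(1,2)])
    fix t assume t: "length t = k" "set t \<subseteq> convex hull set s"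
      "\<And>x y. x \<in> set t \<Longrightarrow> y \<in> set t \<Longrightarrow> dist x y \<le> (real k - 1) / real k * d"
    have "convex hull set t \<subseteq> convex hull set s"
      using t(2) by (simp add: hull_minimal)
    then show "subdivs m k \<phi> t = subdivs m k \<psi> t"
      using t Suc.prems(3) by (intro Suc.IH[where d="(real k - 1) / real k * d"]) (auto simp: algebra_simps)
  qed
  then show ?case
    by simp
qed

lemma subdivs_0:
  fixes s :: "'a::real_vector list"
  shows "subdivs m k (\<lambda>t. 0) s = 0"
proof (induction m arbitrary: s)
  case (Suc m)
  then have "subdivs m k (\<lambda>t. 0) = (\<lambda>t :: 'a list. 0)"
    by (simp add: fun_eq_iff)
  then show ?case
    by (simp add: subdiv_0)
qed simp

lemma subdivs_add: "subdivs m k (\<lambda>t. \<phi> t + \<psi> t) s = subdivs m k \<phi> s + subdivs m k \<psi> s"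
proof (induction m arbitrary: s)
  case (Suc m)
  show ?case
    by (simp add: Suc.IH[abs_def] subdiv_add)
qed simp

lemma subdivs_uminus: "subdivs m k (\<lambda>t. \<phi> (map uminus t)) s = subdivs m k \<phi> (map uminus s)"
proof (induction m arbitrary: s)
  case (Suc m)
  show ?case
    by (simp add: Suc.IH[abs_def] subdiv_uminus)
qed simp

text \<open>As \<open>subdiv_cob\<close> speaks of lists of one length only, the induction passes
  through \<open>subdiv_cong\<close> instead of rewriting under the operator. Any bound
  \<open>d\<close> on the diameter will do.\<close>

lemma subdivs_cob:
  fixes s :: "'a::real_normed_vector list"
  shows "length s = Suc k \<Longrightarrow> subdivs m (Suc k) (cob \<phi>) s = cob (subdivs m k \<phi>) s"
proof (induction m arbitrary: s)
  case (Suc m)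
  obtain d where "\<And>x y. x \<in> set s \<Longrightarrow> y \<in> set s \<Longrightarrow> dist x y \<le> d"
    using finite_imp_bounded[of "set s"] by (auto simp: bounded_two_points)
  then have "subdiv (Suc k) (subdivs m (Suc k) (cob \<phi>)) s = subdiv (Suc k) (cob (subdivs m k \<phi>)) s"
    by (rule subdiv_cong[OF Suc.prems]) (use Suc.IH in \<open>auto simp del: subdiv.simps\<close>)
  also have "\<dots> = cob (subdiv k (subdivs m k \<phi>)) s"
    using Suc.prems by (rule subdiv_cob)
  finally show ?case
    by (simp only: funpow.simps o_apply)
qed simp

section \<open>Cup products of coboundaries\<close>

text \<open>The cup product of the coboundaries of the \<open>0\<close>-cochains \<open>a (k - 1), \<dots>, a 0\<close>.\<close>

fun cup :: "(nat \<Rightarrow> 'a \<Rightarrow> bit) \<Rightarrow> nat \<Rightarrow> 'a list \<Rightarrow> bit" where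
  "cup a 0 [x] = 1"
| "cup a (Suc k) (x # y # s) = (a k x + a k y) * cup a k (y # s)"
| "cup a k s = 0"

text \<open>Here \<open>a k\<close> itself, not its coboundary, is the first factor. This makes
  \<open>cup1 a k\<close> an explicit primitive of \<open>cup a (Suc k)\<close>.\<close>

definition cup1 :: "(nat \<Rightarrow> 'a \<Rightarrow> bit) \<Rightarrow> nat \<Rightarrow> 'a list \<Rightarrow> bit" where
  "cup1 a k s = (case s of [] \<Rightarrow> 0 | x # _ \<Rightarrow> a k x * cup a k s)"

lemma cob_mult: "cob (\<lambda>t. c * \<phi> t) s = c * cob \<phi> s"
  by (induction s arbitrary: \<phi>) (simp_all add: algebra_simps)

lemma cup_eq_0: "length s \<noteq> Suc k \<Longrightarrow> cup a k s = 0"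
  by (induction a k s rule: cup.induct) auto

text \<open>Leibniz rule: when \<open>cup a k\<close> is closed, only the factor \<open>a k\<close>
  is differentiated. \<open>cob_cup\<close> obtains the closedness by induction from this very
  step.\<close>

lemma cob_cup1_step:
  assumes "\<And>s. cob (cup a k) s = 0"
  shows "cob (cup1 a k) s = cup a (Suc k) s"
proof (cases s rule: remdups_adj.cases)
  case 1
  then show ?thesis by simp
next
  case (2 x)
  then show ?thesis by (simp add: cup1_def)
next
  case (3 x y t)
  \<comment> \<open>Closedness on \<open>x # y # t\<close> trades the faces that keep
    \<open>x\<close> for the one that omits it.\<close>
  have *: "cob (\<lambda>t. cup a k (x # t)) (y # t) = cup a k (y # t)"
  proof -
    have "cup a k (y # t) + cob (\<lambda>t. cup a k (x # t)) (y # t) = 0"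
      using assms[of "x # y # t"] by simp
    then show ?thesis
      by (metis bit_add_self_left add_0_right)
  qed
  have "cob (cup1 a k) s = a k y * cup a k (y # t) + cob (\<lambda>t. a k x * cup a k (x # t)) (y # t)"
    using 3 by (simp add: cup1_def)
  also have "\<dots> = cup a (Suc k) s"
    unfolding cob_mult * using 3 by (simp add: algebra_simps)
  finally show ?thesis .
qed

lemma cob_cup: "cob (cup a k) s = 0"
proof (induction k arbitrary: s)
  case 0
  consider "s = []" | x where "s = [x]" | x y where "s = [x, y]" | x y z t where "s = x # y # z # t"
    by (metis list.exhaust)
  then show ?case
  proof cases
    case 4
    then show ?thesis
      using cob_cong[of s "cup a 0" "\<lambda>t. 0"] by (auto simp: cob_0 cup_eq_0)
  qed (auto simp: bit_add_self)
next
  case (Suc k)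
  have "cup a (Suc k) = cob (cup1 a k)"
    using cob_cup1_step[of a k, OF Suc.IH] by (simp add: fun_eq_iff)
  then show ?case
    by (simp add: cob_cob)
qed

lemma cob_cup1: "cob (cup1 a k) s = cup a (Suc k) s"
  by (rule cob_cup1_step) (rule cob_cup)


section \<open>The Borsuk-Ulam theorem\<close>

text \<open>\<open>octa e k\<close> and \<open>hemi e k\<close> evaluate a functional on the fundamental chains of the boundary of
  the cross-polytope with vertices \<open>\<plusminus>e 0, \<dots>, \<plusminus>e (k - 1)\<close> and of an upper hemisphere of the one with
  vertices up to \<open>\<plusminus>e k\<close>.\<close>

primrec octa :: "(nat \<Rightarrow> 'a::uminus) \<Rightarrow> nat \<Rightarrow> ('a list \<Rightarrow> bit) \<Rightarrow> bit" where
  "octa e 0 \<phi> = \<phi> []"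
| "octa e (Suc k) \<phi> = octa e k (\<lambda>t. \<phi> (e k # t)) + octa e k (\<lambda>t. \<phi> (- e k # t))"

definition hemi :: "(nat \<Rightarrow> 'a::uminus) \<Rightarrow> nat \<Rightarrow> ('a list \<Rightarrow> bit) \<Rightarrow> bit" where
  "hemi e k \<phi> = octa e k (\<lambda>t. \<phi> (e k # t))"

primrec face :: "(nat \<Rightarrow> 'a::uminus) \<Rightarrow> nat \<Rightarrow> 'a list \<Rightarrow> bool" where
  "face e 0 t \<longleftrightarrow> t = []"
| "face e (Suc k) t \<longleftrightarrow> (\<exists>u. face e k u \<and> (t = e k # u \<or> t = - e k # u))"

lemma octa_cong: "(\<And>t. face e k t \<Longrightarrow> \<phi> t = \<psi> t) \<Longrightarrow> octa e k \<phi> = octa e k \<psi>"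
proof (induction k arbitrary: \<phi> \<psi>)
  case (Suc k)
  have "octa e k (\<lambda>t. \<phi> (x # t)) = octa e k (\<lambda>t. \<psi> (x # t))" if "x = e k \<or> x = - e k" for x
    by (rule Suc.IH) (use that in \<open>auto intro!: Suc.prems\<close>)
  then show ?case
    by simp
qed simp

lemma hemi_cong: "(\<And>t. face e (Suc k) t \<Longrightarrow> \<phi> t = \<psi> t) \<Longrightarrow> hemi e k \<phi> = hemi e k \<psi>"
  unfolding hemi_def by (rule octa_cong) auto

lemma octa_add: "octa e k (\<lambda>t. \<phi> t + \<psi> t) = octa e k \<phi> + octa e k \<psi>"
  by (induction k arbitrary: \<phi> \<psi>) (simp_all add: ac_simps)

lemma octa_0: "octa e k (\<lambda>t. 0) = 0"
  by (induction k) simp_all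

text \<open>The sphere consists of two cones over the same lower sphere. The two copies of the base
  cancel mod 2, and the rest vanishes by induction.\<close>

lemma octa_cob: "octa e k (cob \<phi>) = 0"
  by (induction k arbitrary: \<phi>) (simp_all add: octa_add bit_add_self)

lemma hemi_cob: "hemi e k (cob \<phi>) = octa e k \<phi>"
  by (simp add: hemi_def octa_add octa_cob)

lemma octa_uminus:
  fixes e :: "nat \<Rightarrow> 'a::real_vector"
  shows "octa e k (\<lambda>t. \<phi> (map uminus t)) = octa e k \<phi>"
proof (induction k arbitrary: \<phi>)
  case (Suc k)
  show ?case
    using Suc.IH[of "\<lambda>t. \<phi> (e k # t)"] Suc.IH[of "\<lambda>t. \<phi> (- e k # t)"] by (simp add: add.commute)
qed simp

text \<open>The lower sphere is invariant under the antipodal map, so the cone with apex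
  \<open>- e k\<close> is the antipodal image of the cone with apex \<open>e k\<close>.\<close>

lemma octa_Suc_eq_hemi:
  fixes e :: "nat \<Rightarrow> 'a::real_vector"
  shows "octa e (Suc k) \<phi> = hemi e k (\<lambda>t. \<phi> t + \<phi> (map uminus t))"
  using octa_uminus[of e k "\<lambda>t. \<phi> (- e k # t)"] by (simp add: hemi_def octa_add)

lemma length_face: "face e k t \<Longrightarrow> length t = k"
  by (induction k arbitrary: t) auto

lemma finite_face: "finite {t. face e k t}"
proof (induction k)
  case (Suc k)
  have "{t. face e (Suc k) t} = Cons (e k) ` {t. face e k t} \<union> Cons (- e k) ` {t. face e k t}"
    by auto
  then show ?case
    using Suc by simp
qed simp

text \<open>Taking for \<open>c i\<close> the sign with which \<open>\<plusminus>e i\<close> occurs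
  in the face exhibits an affine hyperplane through the face that misses the origin.\<close>

lemma face_functional:
  fixes e :: "nat \<Rightarrow> 'a::real_vector" and \<pi> :: "nat \<Rightarrow> 'a \<Rightarrow> real"
  assumes lin: "\<And>i. linear (\<pi> i)" and dual: "\<And>i j. \<pi> i (e j) = (if i = j then 1 else 0)"
  shows "face e k t \<Longrightarrow> \<exists>c. \<forall>v\<in>set t. (\<Sum>i<k. c i * \<pi> i v) = 1"
proof (induction k arbitrary: t)
  case (Suc k)
  then obtain u and \<sigma> :: real where u: "face e k u" and t: "t = (\<sigma> *\<^sub>R e k) # u" and \<sigma>: "\<sigma> = 1 \<or> \<sigma> = -1"
    by (metis face.simps(2) scaleR_one scaleR_minus1_left)
  obtain c where c: "\<forall>v\<in>set u. (\<Sum>i<k. c i * \<pi> i v) = 1"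
    using Suc.IH[OF u] by blast
  have \<pi>u: "\<pi> k v = 0" if "v \<in> set u" for v
    using u that
  proof -
    have "face e j u \<Longrightarrow> j \<le> k \<Longrightarrow> v \<in> set u \<Longrightarrow> \<pi> k v = 0" for j
      by (induction j arbitrary: u) (auto simp: dual linear_neg[OF lin])
    then show ?thesis
      using u that by blast
  qed
  have "(\<Sum>i<Suc k. (c(k := \<sigma>)) i * \<pi> i v) = 1" if "v \<in> set t" for v
  proof (cases "v \<in> set u")
    case True
    then show ?thesis
      using c \<pi>u by simp
  next
    case False
    then have "v = \<sigma> *\<^sub>R e k"
      using that t by simp
    then show ?thesis
      using \<sigma> by (auto simp: linear_cmul[OF lin] dual)
  qed
  then show ?case
    by blast
qed simp

text \<open>This keeps all subdivided simplices inside the region where the functions of the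
  Borsuk-Ulam theorem are continuous.\<close>

lemma hull_face_nonzero:
  fixes e :: "nat \<Rightarrow> 'a::real_vector" and \<pi> :: "nat \<Rightarrow> 'a \<Rightarrow> real"
  assumes lin: "\<And>i. linear (\<pi> i)" and dual: "\<And>i j. \<pi> i (e j) = (if i = j then 1 else 0)"
    and "face e k t" "x \<in> convex hull set t"
  shows "\<exists>i<k. \<pi> i x \<noteq> 0"
proof -
  obtain c where c: "\<forall>v\<in>set t. (\<Sum>i<k. c i * \<pi> i v) = 1"
    using face_functional[OF lin dual assms(3)] by blast
  have "linear (\<lambda>v. \<Sum>i<k. c i * \<pi> i v)"
    using linear_compose_scale_right[OF lin] by (intro linear_compose_sum) auto
  then have "convex ((\<lambda>v. \<Sum>i<k. c i * \<pi> i v) -` {1})"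
    by (intro convex_linear_vimage) auto
  then have "convex hull set t \<subseteq> (\<lambda>v. \<Sum>i<k. c i * \<pi> i v) -` {1}"
    using c by (intro hull_minimal) auto
  then have "(\<Sum>i<k. c i * \<pi> i x) = 1"
    using assms(4) by auto
  then have "\<not> (\<forall>i<k. \<pi> i x = 0)"
    by (metis (no_types, lifting) lessThan_iff mult_zero_right sum.neutral zero_neq_one)
  then show ?thesis
    by blast
qed

text \<open>The factor with index \<open>j\<close> is a sum of two values of \<open>a j\<close>,
  here \<open>c + c = 0\<close>.\<close>

lemma cup_eq_0_const: "j < k \<Longrightarrow> (\<And>x. x \<in> set s \<Longrightarrow> a j x = c) \<Longrightarrow> cup a k s = 0"
proof (induction a k s rule: cup.induct)
  case (2 a k x y s)
  show ?case
  proof (cases "j = k")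
    case True
    then show ?thesis
      using 2 by (simp add: bit_add_self)
  next
    case False
    then show ?thesis
      using 2 by simp
  qed
qed auto

text \<open>Values of the cochains enter only through sums \<open>a j x + a j y\<close>, in which
  the two added ones cancel.\<close>

lemma cup_uminus:
  fixes s :: "'a::real_vector list"
  assumes a: "\<And>j x. j < n \<Longrightarrow> x \<noteq> 0 \<Longrightarrow> a j (- x) = 1 + a j x"
  shows "k \<le> n \<Longrightarrow> 0 \<notin> set s \<Longrightarrow> cup a k (map uminus s) = cup a k s"
proof (induction k arbitrary: s)
  case 0
  then show ?case
    by (cases "(a, 0::nat, s)" rule: cup.cases) auto
next
  case (Suc k)
  show ?case
  proof (cases s rule: remdups_adj.cases)
    case (3 x y t)
    have "cup a k (map uminus (y # t)) = cup a k (y # t)"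
      by (rule Suc.IH) (use Suc.prems 3 in auto)
    moreover have "a k (- x) + a k (- y) = a k x + a k y"
      using Suc.prems 3 a[of k x] a[of k y] by (simp add: ac_simps bit_add_self_left)
    ultimately show ?thesis
      using 3 by simp
  qed auto
qed

text \<open>Choose one point from each pair \<open>x\<close>, \<open>- x\<close>; the pair is
  described symmetrically, so both points lead to the same choice. The selector will break ties
  where a function vanishes.\<close>

lemma exists_antipodal_selector:
  "\<exists>h :: 'a::real_vector \<Rightarrow> bool. \<forall>x. x \<noteq> 0 \<longrightarrow> h (- x) \<longleftrightarrow> \<not> h x"
proof -
  define h where "h x \<longleftrightarrow> x = (SOME y. y = x \<or> y = - x)" for x :: 'a
  have "h (- x) \<longleftrightarrow> \<not> h x" if "x \<noteq> 0" for x :: 'a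
  proof -
    define y where "y = (SOME y. y = x \<or> y = - x)"
    have "(\<lambda>y. y = - x \<or> y = - (- x)) = (\<lambda>y. y = x \<or> y = - x)"
      by auto
    then have "h (- x) \<longleftrightarrow> - x = y" "h x \<longleftrightarrow> x = y"
      unfolding h_def y_def by simp_all
    moreover have "y = x \<or> y = - x"
      unfolding y_def by (rule someI[of "\<lambda>y. y = x \<or> y = - x" x]) simp
    moreover have "x \<noteq> - x"
      using that by (metis eq_neg_iff_add_eq_0 scaleR_2 scaleR_eq_0_iff zero_neq_numeral)
    ultimately show ?thesis
      by auto
  qed
  then show ?thesis
    by blast
qed

text \<open>Working with functionals \<open>\<pi> i\<close> dual to an infinite family
  \<open>e i\<close> accommodates every \<open>n\<close> within a single normed space.\<close>

lemma borsuk_ulam_normed: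
  fixes e :: "nat \<Rightarrow> 'a::real_normed_vector" and \<pi> :: "nat \<Rightarrow> 'a \<Rightarrow> real"
  assumes bounded_linear: "\<And>i. bounded_linear (\<pi> i)"
    and dual: "\<And>i j. \<pi> i (e j) = (if i = j then 1 else 0)"
    and cont: "\<And>j. j < n \<Longrightarrow> continuous_on {x. \<exists>i\<le>n. \<pi> i x \<noteq> 0} (F j :: 'a \<Rightarrow> real)"
    and odd: "\<And>j x. j < n \<Longrightarrow> F j (- x) = - F j x"
  shows "\<exists>x. (\<exists>i\<le>n. \<pi> i x \<noteq> 0) \<and> (\<forall>j<n. F j x = 0)"
proof (rule ccontr)
  define S where "S = {x. \<exists>i\<le>n. \<pi> i x \<noteq> 0}"
  note lin = bounded_linear.linear[OF bounded_linear]
  have "open {x. \<pi> i x \<noteq> 0}" for i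
    by (intro open_Collect_neq linear_continuous_on[OF bounded_linear] continuous_on_const)
  moreover have "S = (\<Union>i\<in>{..n}. {x. \<pi> i x \<noteq> 0})"
    by (auto simp: S_def)
  ultimately have "open S"
    by auto
  assume contra: "\<nexists>x. (\<exists>i\<le>n. \<pi> i x \<noteq> 0) \<and> (\<forall>j<n. F j x = 0)"
  define K where "K = (\<Union>t\<in>{t. face e (Suc n) t}. convex hull set t)"
  have "compact K"
    unfolding K_def using finite_face by (intro compact_UN) (auto intro: finite_imp_compact_convex_hull)
  \<comment> \<open>On each set of this open cover some \<open>F j\<close> has a strict sign. Its
    Lebesgue number decides how fine the subdivision must be.\<close>
  define \<G> where "\<G> = (\<lambda>j. {x \<in> S. F j x \<in> {0<..}}) ` {..<n} \<union> (\<lambda>j. {x \<in> S. F j x \<in> {..<0}}) ` {..<n}"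
  have "open {x \<in> S. F j x \<in> U}" if "j \<in> {..<n}" "open U" for j U
    using continuous_open_preimage[OF cont[folded S_def] \<open>open S\<close> that(2)] that(1)
    by (simp add: Int_def vimage_def)
  then have "open G" if "G \<in> \<G>" for G
    using that unfolding \<G>_def by (elim UnE imageE) (simp_all only: open_greaterThan open_lessThan)
  moreover have "K \<subseteq> \<Union>\<G>"
  proof
    fix x assume "x \<in> K"
    then obtain i where "i < Suc n" "\<pi> i x \<noteq> 0"
      unfolding K_def using hull_face_nonzero[OF lin dual] by blast
    then have "x \<in> S"
      by (auto simp: S_def less_Suc_eq_le)
    moreover from this obtain j where "j < n" "F j x \<noteq> 0"
      using contra by (auto simp: S_def)
    ultimately have "x \<in> {x \<in> S. F j x \<in> {0<..}} \<or> x \<in> {x \<in> S. F j x \<in> {..<0}}"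
      by auto
    then show "x \<in> \<Union>\<G>"
      using \<open>j < n\<close> unfolding \<G>_def by blast
  qed
  ultimately obtain \<epsilon> where \<epsilon>: "0 < \<epsilon>" "\<And>x. x \<in> K \<Longrightarrow> \<exists>G\<in>\<G>. ball x \<epsilon> \<subseteq> G"
    using Heine_Borel_lemma[OF \<open>compact K\<close>] by metis
  obtain d where d: "\<And>x y. x \<in> K \<Longrightarrow> y \<in> K \<Longrightarrow> dist x y \<le> d"
    using compact_imp_bounded[OF \<open>compact K\<close>] by (auto simp: bounded_two_points)
  \<comment> \<open>\<open>n / Suc n\<close> is the mesh factor of one subdivision of simplices with
    \<open>Suc n\<close> vertices.\<close>
  have "(\<lambda>m. (real n / real (Suc n)) ^ m * d) \<longlonglongrightarrow> 0 * d"
    by (intro tendsto_intros LIMSEQ_power_zero) (simp add: field_simps)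
  then have "eventually (\<lambda>m. (real n / real (Suc n)) ^ m * d < \<epsilon>) sequentially"
    using \<epsilon>(1) by (intro order_tendstoD) auto
  then obtain m where m: "(real n / real (Suc n)) ^ m * d < \<epsilon>"
    by (auto simp: eventually_sequentially)

  obtain h :: "'a \<Rightarrow> bool" where h: "\<And>x. x \<noteq> 0 \<Longrightarrow> h (- x) \<longleftrightarrow> \<not> h x"
    using exists_antipodal_selector by blast
  \<comment> \<open>The tie-breaker \<open>h\<close> makes the values at antipodal points differ
    even where \<open>F j\<close> vanishes.\<close>
  define a :: "nat \<Rightarrow> 'a \<Rightarrow> bit" where "a j x = of_bool (0 < F j x \<or> F j x = 0 \<and> h x)" for j x
  have a_uminus: "a j (- x) = 1 + a j x" if "j < n" "x \<noteq> 0" for j x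
    using odd[OF that(1)] h[OF that(2)] by (auto simp: a_def bit_add_self)
  have hull_nonzero: "0 \<notin> convex hull set t" if "face e k t" for t k
    using hull_face_nonzero[OF lin dual that] linear_0[OF lin] by blast

  have hemi_cup: "k \<le> n \<Longrightarrow> hemi e k (subdivs m (Suc k) (cup a k)) = 1" for k
  proof (induction k)
    case 0
    have "subdivs m (Suc 0) (cup a 0) [x] = subdivs m (Suc 0) (\<lambda>t. 1) [x]" for x :: 'a
      by (rule subdivs_cong[where d=0]) (auto simp: length_Suc_conv)
    moreover have "subdivs m (Suc 0) (\<lambda>t. 1) [x] = 1" for x :: 'a
    proof -
      have "length t = 1 \<Longrightarrow> subdivs m (Suc 0) (\<lambda>t. 1) t = 1" for t :: "'a list"
      proof (induction m arbitrary: t)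
        case (Suc m)
        have "subdiv (Suc 0) (subdivs m (Suc 0) (\<lambda>t. 1)) t = subdiv (Suc 0) (\<lambda>t. 1) t"
          by (rule subdiv_cong[where d=0]) (use Suc in \<open>auto simp: length_Suc_conv simp del: subdiv.simps\<close>)
        also have "\<dots> = 1"
          using Suc.prems by (auto simp: length_Suc_conv)
        finally show ?case
          by (simp only: funpow.simps o_apply)
      qed simp
      then show ?thesis
        by simp
    qed
    ultimately show ?case
      by (simp add: hemi_def del: subdiv.simps)
  next
    case (Suc k)
    define g where "g = subdivs m (Suc k) (cup1 a k)"
    have "hemi e (Suc k) (subdivs m (Suc (Suc k)) (cup a (Suc k))) = hemi e (Suc k) (cob g)"
      unfolding g_def cob_cup1[abs_def, symmetric]
      by (intro hemi_cong subdivs_cob) (auto dest: length_face)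
    \<comment> \<open>The boundary of a hemisphere is the sphere one dimension lower, which is a
      smaller hemisphere together with its antipode.\<close>
    also have "\<dots> = hemi e k (\<lambda>t. g t + g (map uminus t))"
      by (simp only: hemi_cob octa_Suc_eq_hemi)
    also have "\<dots> = hemi e k (subdivs m (Suc k) (cup a k))"
    proof (rule hemi_cong)
      fix t assume t: "face e (Suc k) t"
      obtain d where d: "\<And>x y. x \<in> set t \<Longrightarrow> y \<in> set t \<Longrightarrow> dist x y \<le> d"
        using finite_imp_bounded[of "set t"] by (auto simp: bounded_two_points)
      have "g t + g (map uminus t) = subdivs m (Suc k) (\<lambda>u. cup1 a k u + cup1 a k (map uminus u)) t"
        by (simp only: g_def subdivs_uminus[symmetric] subdivs_add)
      also have "\<dots> = subdivs m (Suc k) (cup a k) t"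
      proof (rule subdivs_cong[OF length_face[OF t] d])
        fix u assume u: "length u = Suc k" "set u \<subseteq> convex hull set t"
        then obtain x v where xv: "u = x # v"
          by (auto simp: length_Suc_conv)
        have "0 \<notin> set u"
          using u hull_nonzero[OF t] by blast
        \<comment> \<open>On \<open>u\<close> and its antipode the cup factors agree, while the
          values of \<open>a k\<close> at the first vertices add up to 1.\<close>
        then have "cup a k (map uminus u) = cup a k u" "a k (- x) = 1 + a k x"
          using Suc.prems xv by (auto intro!: cup_uminus a_uminus simp del: list.map)
        then show "cup1 a k u + cup1 a k (map uminus u) = cup a k u"
          using xv by (simp add: cup1_def algebra_simps bit_add_self_left)
      qed
      finally show "g t + g (map uminus t) = subdivs m (Suc k) (cup a k) t" .
    qed
    also have "\<dots> = 1"
      using Suc by (simp del: subdiv.simps)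
    finally show ?case .
  qed
  have "hemi e n (subdivs m (Suc n) (cup a n)) = hemi e n (\<lambda>t. 0)"
  proof (rule hemi_cong)
    fix t assume t: "face e (Suc n) t"
    then have tK: "convex hull set t \<subseteq> K"
      by (auto simp: K_def)
    have "subdivs m (Suc n) (cup a n) t = subdivs m (Suc n) (\<lambda>u. 0) t"
    proof (rule subdivs_cong[OF length_face[OF t]])
      show "dist x y \<le> d" if "x \<in> set t" "y \<in> set t" for x y
        using that tK hull_inc[of _ "set t" convex] by (intro d) (auto simp: subset_iff)
      fix u assume u: "length u = Suc n" "set u \<subseteq> convex hull set t"
        "\<And>x y. x \<in> set u \<Longrightarrow> y \<in> set u \<Longrightarrow> dist x y \<le> ((real (Suc n) - 1) / real (Suc n)) ^ m * d"
      then have hd: "hd u \<in> set u"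
        by (intro hd_in_set) auto
      then obtain G where G: "G \<in> \<G>" "ball (hd u) \<epsilon> \<subseteq> G"
        using \<epsilon>(2)[of "hd u"] u(2) tK by blast
      \<comment> \<open>The subdivided simplex has diameter below \<open>\<epsilon>\<close>, so the
        ball around its first vertex contains all of it.\<close>
      have "set u \<subseteq> ball (hd u) \<epsilon>"
        using u(3)[OF hd] m by force
      then have "set u \<subseteq> G"
        using G by blast
      then obtain j where j: "j < n" "(\<forall>x\<in>set u. 0 < F j x) \<or> (\<forall>x\<in>set u. F j x < 0)"
        using G(1) unfolding \<G>_def by fastforce
      then have "\<forall>x\<in>set u. a j x = of_bool (\<forall>x\<in>set u. 0 < F j x)"
        using hd by (auto simp: a_def)
      then show "cup a n u = 0"
        by (intro cup_eq_0_const[OF j(1), where c="of_bool (\<forall>x\<in>set u. 0 < F j x)"]) blast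
    qed
    also have "\<dots> = 0"
      by (rule subdivs_0)
    finally show "subdivs m (Suc n) (cup a n) t = 0" .
  qed
  then show False
    using hemi_cup[of n] by (simp add: hemi_def octa_0)
qed

theorem borsuk_ulam:
  fixes F :: "nat \<Rightarrow> (nat \<Rightarrow> real) \<Rightarrow> real"
  assumes cont: "\<And>j. j < n \<Longrightarrow> continuous_on {c. \<exists>i\<le>n. c i \<noteq> 0} (F j)"
    and odd: "\<And>j c. j < n \<Longrightarrow> F j (\<lambda>i. - c i) = - F j c"
  shows "\<exists>c. (\<exists>i\<le>n. c i \<noteq> 0) \<and> (\<forall>j<n. F j c = 0)"
proof -
  \<comment> \<open>Bounded sequences with the supremum norm contain all finite dimensions at once;
    \<open>e k\<close> is a unit sequence.\<close>
  define e :: "nat \<Rightarrow> nat \<Rightarrow>\<^sub>C real" where "e k = Bcontfun (\<lambda>i. if i = k then 1 else 0)" for k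
  have e: "apply_bcontfun (e k) i = (if i = k then 1 else 0)" for k i
  proof -
    have "(\<lambda>i. if i = k then 1 else 0 :: real) \<in> bcontfun"
      by (rule bcontfun_normI[where b=1]) auto
    then show ?thesis
      by (simp add: e_def Bcontfun_inverse)
  qed
  have "\<exists>x. (\<exists>i\<le>n. apply_bcontfun x i \<noteq> 0) \<and> (\<forall>j<n. F j (apply_bcontfun x) = 0)"
  proof (rule borsuk_ulam_normed[where \<pi>="\<lambda>i x. apply_bcontfun x i" and e=e])
    have norm: "\<bar>apply_bcontfun x i\<bar> \<le> norm x" for x :: "nat \<Rightarrow>\<^sub>C real" and i
      using norm_bounded[of x i] by simp
    then show bl: "bounded_linear (\<lambda>x :: nat \<Rightarrow>\<^sub>C real. apply_bcontfun x i)" for i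
      by (intro bounded_linear_intro[where K=1]) auto
    show "apply_bcontfun (e j) i = (if i = j then 1 else 0)" for i j
      by (simp add: e)
    \<comment> \<open>Norm convergence implies coordinatewise convergence, the topology in which
      \<open>F j\<close> is assumed continuous.\<close>
    have "continuous_on A (apply_bcontfun :: (nat \<Rightarrow>\<^sub>C real) \<Rightarrow> nat \<Rightarrow> real)" for A
      by (rule continuous_on_coordinatewise_then_product) (rule linear_continuous_on[OF bl])
    then show "continuous_on {x. \<exists>i\<le>n. apply_bcontfun x i \<noteq> 0} (\<lambda>x :: nat \<Rightarrow>\<^sub>C real. F j (apply_bcontfun x))"
      if "j < n" for j
      by (rule continuous_on_compose2[OF cont[OF that]]) auto
    show "F j (apply_bcontfun (- x)) = - F j (apply_bcontfun x)" if "j < n" for j and x :: "nat \<Rightarrow>\<^sub>C real"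
      using odd[OF that, of "apply_bcontfun x"] by (simp add: uminus_bcontfun.rep_eq fun_Compl_def)
  qed
  then show ?thesis
    by blast
qed

section \<open>The ham sandwich theorem\<close>

text \<open>The integral of the sign of \<open>P c\<close> over \<open>B j\<close> is odd in
  \<open>c\<close>, and its vanishing means that \<open>P c\<close> bisects \<open>B j\<close>.
  Borsuk-Ulam matches \<open>n\<close> sets with \<open>n + 1\<close> coefficients.\<close>

theorem ham_sandwich:
  fixes n :: nat and \<phi> :: "nat \<Rightarrow> 'a::euclidean_space \<Rightarrow> real" and B :: "nat \<Rightarrow> 'a set"
  defines "P \<equiv> \<lambda>c x. \<Sum>k\<le>n. c k * \<phi> k x"
  assumes meas: "\<And>k. \<phi> k \<in> borel_measurable borel"
    and B: "\<And>j. j < n \<Longrightarrow> B j \<in> sets borel" "\<And>j. j < n \<Longrightarrow> emeasure lborel (B j) < \<infinity>"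
    and null: "\<And>c. (\<exists>k\<le>n. c k \<noteq> 0) \<Longrightarrow> {x. P c x = 0} \<in> null_sets lborel"
  shows "\<exists>c. (\<exists>k\<le>n. c k \<noteq> 0) \<and>
    (\<forall>j<n. measure lborel {x \<in> B j. 0 < P c x} = measure lborel (B j) / 2)"
proof -
  have meas_P [measurable]: "P c \<in> borel_measurable borel" for c
    unfolding P_def using meas by measurable
  define F where "F j c = (LINT x|lborel. indicator (B j) x * sgn (P c x))" for j c
  have AE: "AE x in lborel. P c x \<noteq> 0" if "\<exists>k\<le>n. c k \<noteq> 0" for c
    using AE_not_in[OF null[OF that]] by simp
  have "\<exists>c. (\<exists>k\<le>n. c k \<noteq> 0) \<and> (\<forall>j<n. F j c = 0)"
  proof (rule borsuk_ulam)
    fix j assume "j < n"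
    note [measurable] = B(1)[OF \<open>j < n\<close>]
    show "continuous_on {c. \<exists>k\<le>n. c k \<noteq> 0} (F j)"
      unfolding continuous_on_sequentially
    proof (intro allI ballI impI, elim conjE)
      fix X :: "nat \<Rightarrow> nat \<Rightarrow> real" and c assume c: "c \<in> {c. \<exists>k\<le>n. c k \<noteq> 0}" and X: "X \<longlonglongrightarrow> c"
      have coord: "(\<lambda>m. X m k) \<longlonglongrightarrow> c k" for k
        by (rule continuous_on_tendsto_compose[OF continuous_on_product_coordinates X]) auto
      \<comment> \<open>The sign of \<open>P c x\<close> is continuous in \<open>c\<close> wherever
        \<open>P c x\<close> is nonzero, hence for almost all \<open>x\<close>; the indicator of
        \<open>B j\<close> dominates.\<close>
      show "(F j \<circ> X) \<longlonglongrightarrow> F j c"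
        unfolding F_def o_def
      proof (rule integral_dominated_convergence[where w="indicator (B j)"])
        show "integrable lborel (indicator (B j) :: 'a \<Rightarrow> real)"
          using B(2)[OF \<open>j < n\<close>] by simp
        have "(\<lambda>m. P (X m) x) \<longlonglongrightarrow> P c x" for x
          unfolding P_def by (intro tendsto_intros coord)
        then show "AE x in lborel. (\<lambda>m. indicator (B j) x * sgn (P (X m) x)) \<longlonglongrightarrow> indicator (B j) x * sgn (P c x)"
          using AE[of c] c by (auto elim!: eventually_mono intro!: tendsto_intros)
      qed (auto simp: sgn_real_def split: split_indicator)
    qed
    show "F j (\<lambda>i. - c i) = - F j c" for c
      by (simp add: F_def P_def sum_negf sgn_minus)
  qed
  then obtain c where c: "\<exists>k\<le>n. c k \<noteq> 0" and F0: "\<And>j. j < n \<Longrightarrow> F j c = 0"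
    by blast
  have "measure lborel {x \<in> B j. 0 < P c x} = measure lborel (B j) / 2" if "j < n" for j
  proof -
    note [measurable] = B(1)[OF that]
    have fin: "emeasure lborel {x \<in> B j. 0 < P c x} < \<infinity>"
      by (rule le_less_trans[OF emeasure_mono B(2)[OF that]]) auto
    have "0 = F j c"
      by (simp add: F0 that)
    also have "\<dots> = (LINT x|lborel. 2 * indicator {x \<in> B j. 0 < P c x} x - indicator (B j) x)"
      unfolding F_def
    proof (rule integral_cong_AE)
      show "AE x in lborel. indicator (B j) x * sgn (P c x) = 2 * indicator {x \<in> B j. 0 < P c x} x - indicator (B j) x"
        using AE[OF c] by (auto elim!: eventually_mono simp: sgn_real_def split: split_indicator)
    qed auto
    also have "\<dots> = 2 * measure lborel {x \<in> B j. 0 < P c x} - measure lborel (B j)"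
      using fin B(2)[OF that] by (subst Bochner_Integration.integral_diff) auto
    finally show ?thesis
      by simp
  qed
  with c show ?thesis
    by blast
qed

section \<open>Zeros on lines\<close>

text \<open>Integrate the number of sets \<open>S i\<close> that contain a given point.\<close>

lemma sum_measure_le_multiplicity:
  fixes S :: "'i \<Rightarrow> 'a set"
  assumes "finite I" and S: "\<And>i. i \<in> I \<Longrightarrow> S i \<in> sets M" "\<And>i. i \<in> I \<Longrightarrow> S i \<subseteq> U"
    and U: "U \<in> sets M" "emeasure M U < \<infinity>"
    and D: "\<And>x. x \<in> U \<Longrightarrow> card {i \<in> I. x \<in> S i} \<le> D"
  shows "(\<Sum>i\<in>I. measure M (S i)) \<le> real D * measure M U"
proof -
  have fin: "emeasure M (S i) < \<infinity>" if "i \<in> I" for i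
    by (rule le_less_trans[OF emeasure_mono U(2)]) (use S U that in auto)
  have "(\<Sum>i\<in>I. measure M (S i)) = (LINT x|M. (\<Sum>i\<in>I. indicator (S i) x))"
    using S fin by (subst Bochner_Integration.integral_sum) (auto intro!: sum.cong simp: sets.sets_into_space Int_absorb2 Int_absorb1)
  also have "\<dots> \<le> (LINT x|M. real D * indicator U x)"
  proof (rule integral_mono)
    show "integrable M (\<lambda>x. \<Sum>i\<in>I. indicator (S i) x :: real)"
      using S fin by (intro Bochner_Integration.integrable_sum) auto
    show "integrable M (\<lambda>x. real D * indicator U x)"
      using U by auto
    show "(\<Sum>i\<in>I. indicator (S i) x) \<le> real D * indicator U x" for x
    proof (cases "x \<in> U")
      case True
      have "(\<Sum>i\<in>I. indicator (S i) x :: real) = real (card {i \<in> I. x \<in> S i})"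
        using \<open>finite I\<close> by (simp add: indicator_def sum.If_cases Int_def)
      then show ?thesis
        using True D[of x] by simp
    next
      case False
      then have "(\<Sum>i\<in>I. indicator (S i) x :: real) = 0"
        using S(2) by (intro sum.neutral) (auto simp: indicator_def)
      then show ?thesis
        using False by simp
    qed
  qed
  also have "\<dots> = real D * measure M U"
    using U by (simp add: sets.sets_into_space Int_absorb2 Int_absorb1)
  finally show ?thesis .
qed

text \<open>The degree bound is expressed through restrictions to lines because the degree enters
  the argument only by counting zeros there.\<close>

definition poly_on_lines :: "nat \<Rightarrow> ('a::real_vector \<Rightarrow> real) \<Rightarrow> bool" where
  "poly_on_lines D P \<longleftrightarrow> (\<forall>x v. \<exists>q. degree q \<le> D \<and> (\<forall>t. P (x + t *\<^sub>R v) = poly q t))"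

lemma card_zeros_on_line:
  assumes "poly_on_lines D P" "P (x + t0 *\<^sub>R v) \<noteq> 0"
  shows "finite {t. P (x + t *\<^sub>R v) = 0}" "card {t. P (x + t *\<^sub>R v) = 0} \<le> D"
proof -
  obtain q where q: "degree q \<le> D" "\<And>t. P (x + t *\<^sub>R v) = poly q t"
    using assms(1) unfolding poly_on_lines_def by blast
  then have "q \<noteq> 0"
    using assms(2) by auto
  then show "finite {t. P (x + t *\<^sub>R v) = 0}" "card {t. P (x + t *\<^sub>R v) = 0} \<le> D"
    using poly_roots_finite[of q] card_poly_roots_bound[of q] q by auto
qed

text \<open>Shrunken copies of the zero set towards \<open>w\<close> overlap at most
  \<open>D\<close> times, since a line through \<open>w\<close> carries at most \<open>D\<close>
  zeros. If the zero set had positive measure, sufficiently many copies would not fit into one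
  ball.\<close>

lemma null_sets_zeros:
  fixes P :: "'a::euclidean_space \<Rightarrow> real"
  assumes P: "poly_on_lines D P" and [measurable]: "P \<in> borel_measurable borel" and w: "P w \<noteq> 0"
  shows "{x. P x = 0} \<in> null_sets lborel"
proof -
  have ball_null: "measure lborel ({x. P x = 0} \<inter> ball w R) = 0" if "R > 0" for R
  proof (rule ccontr)
    define Z where "Z = {x. P x = 0} \<inter> ball w R"
    have [measurable]: "Z \<in> sets borel"
      by (simp add: Z_def)
    define \<mu> where "\<mu> = measure lborel Z"
    assume "measure lborel ({x. P x = 0} \<inter> ball w R) \<noteq> 0"
    then have "\<mu> > 0"
      by (simp add: \<mu>_def Z_def zero_less_measure_iff)
    define V where "V = measure lborel (ball w R)"
    obtain m :: nat where m: "real D * V * 2 ^ DIM('a) < real m * \<mu>"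
      using reals_Archimedean3[OF \<open>\<mu> > 0\<close>] by blast
    have "0 \<le> real D * V * 2 ^ DIM('a)"
      by (simp add: V_def)
    with m have "0 < real m * \<mu>"
      by linarith
    then have "m > 0"
      by (simp add: zero_less_mult_iff)
    \<comment> \<open>Scaling by \<open>1 / r i\<close>, between 1/2 and 1, keeps the copies in the
      ball and costs at most the factor \<open>2 ^ DIM('a)\<close> in measure.\<close>
    define r where "r i = 1 + real i / real m" for i
    have r: "1 \<le> r i" "r i \<le> 2" if "i < m" for i
      using that by (auto simp: r_def field_simps)
    define S where "S i = (\<lambda>x. (1 / r i) *\<^sub>R x + (w - (1 / r i) *\<^sub>R w)) ` Z" for i
    have S_iff: "x \<in> S i \<longleftrightarrow> w + r i *\<^sub>R (x - w) \<in> Z" if "i < m" for i x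
    proof -
      have "x = (1 / r i) *\<^sub>R y + (w - (1 / r i) *\<^sub>R w) \<longleftrightarrow> y = w + r i *\<^sub>R (x - w)" for y
      proof
        assume "x = (1 / r i) *\<^sub>R y + (w - (1 / r i) *\<^sub>R w)"
        then have "x - w = (1 / r i) *\<^sub>R (y - w)"
          by (simp add: algebra_simps)
        then have "r i *\<^sub>R (x - w) = y - w"
          using r(1)[OF that] by simp
        then show "y = w + r i *\<^sub>R (x - w)"
          by simp
      next
        assume y: "y = w + r i *\<^sub>R (x - w)"
        show "x = (1 / r i) *\<^sub>R y + (w - (1 / r i) *\<^sub>R w)"
          using r(1)[OF that] unfolding y by (simp add: scaleR_add_right)
      qed
      then show ?thesis
        unfolding S_def by (simp add: image_iff)
    qed
    have S_borel: "S i \<in> sets lborel" if "i < m" for i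
    proof -
      have "S i = {x \<in> space borel. w + r i *\<^sub>R (x - w) \<in> Z}"
        using S_iff[OF that] by auto
      also have "\<dots> \<in> sets borel"
        by measurable
      finally show ?thesis
        by simp
    qed
    have "(1/2) ^ DIM('a) * \<mu> \<le> measure lborel (S i)" if "i < m" for i
    proof -
      have "measure lborel (S i) = measure lebesgue (S i)"
        using S_borel[OF that] by simp
      also have "\<dots> = (1 / r i) ^ DIM('a) * measure lebesgue Z"
        unfolding S_def measure_lebesgue_affine using r(1)[OF that] by simp
      also have "\<dots> \<ge> (1/2) ^ DIM('a) * \<mu>"
        using r[OF that] by (auto simp: \<mu>_def intro!: mult_right_mono power_mono frac_le)
      finally show ?thesis .
    qed
    then have "(\<Sum>i<m. (1/2) ^ DIM('a) * \<mu>) \<le> (\<Sum>i<m. measure lborel (S i))"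
      by (intro sum_mono) auto
    also have "\<dots> \<le> real D * V"
      unfolding V_def
    proof (rule sum_measure_le_multiplicity)
      show "S i \<subseteq> ball w R" if "i \<in> {..<m}" for i
      proof
        fix x assume "x \<in> S i"
        then have "r i * norm (x - w) < R"
          using S_iff[of i x] that r(1)[of i] by (simp add: Z_def dist_norm)
        moreover have "norm (x - w) \<le> r i * norm (x - w)"
          using r(1)[of i] that by (simp add: mult_le_cancel_right1)
        ultimately show "x \<in> ball w R"
          by (simp add: dist_norm norm_minus_commute)
      qed
      show "card {i \<in> {..<m}. x \<in> S i} \<le> D" for x
      proof -
        have zeros: "finite {t. P (w + t *\<^sub>R (x - w)) = 0}" "card {t. P (w + t *\<^sub>R (x - w)) = 0} \<le> D"
          using card_zeros_on_line[OF P, of w 0] w by auto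
        have "card {i \<in> {..<m}. x \<in> S i} \<le> card {t. P (w + t *\<^sub>R (x - w)) = 0}"
        proof (rule card_inj_on_le[OF _ _ zeros(1)])
          show "inj_on r {i \<in> {..<m}. x \<in> S i}"
            using \<open>m > 0\<close> by (auto simp: inj_on_def r_def)
          show "r ` {i \<in> {..<m}. x \<in> S i} \<subseteq> {t. P (w + t *\<^sub>R (x - w)) = 0}"
            using S_iff by (auto simp: Z_def)
        qed
        with zeros(2) show ?thesis
          by linarith
      qed
    qed (use S_borel emeasure_lborel_ball_finite in \<open>auto simp: less_top\<close>)
    finally show False
      using m by (simp add: field_simps)
  qed
  have "{x. P x = 0} = (\<Union>k. {x. P x = 0} \<inter> ball w (real (Suc k)))"
  proof -
    have "\<exists>k. dist w x < real (Suc k)" for x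
      using reals_Archimedean2[of "dist w x"] by (meson less_trans of_nat_less_iff lessI)
    then show ?thesis
      by auto
  qed
  also have "\<dots> \<in> null_sets lborel"
  proof (rule null_sets_UN)
    fix k
    have "emeasure lborel ({x. P x = 0} \<inter> ball w (real (Suc k))) < \<infinity>"
      by (rule le_less_trans[OF emeasure_mono emeasure_lborel_ball_finite[of w "real (Suc k)"]]) auto
    then show "{x. P x = 0} \<inter> ball w (real (Suc k)) \<in> null_sets lborel"
      using ball_null[of "real (Suc k)"] by (intro null_setsI) (simp_all add: emeasure_eq_ennreal_measure)
  qed
  finally show ?thesis .
qed

section \<open>Sign changes near a bisected ball\<close>

text \<open>By Fubini the overlaps integrate over \<open>h\<close> to the product of the two
  measures, and they vanish outside \<open>E\<close>, so some \<open>h\<close> does no worse than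
  average. The factor 2 lets weak pointwise bounds yield a strict contradiction.\<close>

lemma exists_translation_overlap:
  fixes A C E :: "'a::euclidean_space set"
  assumes borel [measurable]: "A \<in> sets borel" "C \<in> sets borel" "E \<in> sets borel"
    and fin: "emeasure lborel A < \<infinity>" "emeasure lborel C < \<infinity>" "emeasure lborel E < \<infinity>"
    and pos: "0 < measure lborel A" "0 < measure lborel C" "0 < measure lborel E"
    and diff: "\<And>x y. x \<in> A \<Longrightarrow> y \<in> C \<Longrightarrow> y - x \<in> E"
  shows "\<exists>h\<in>E. measure lborel A * measure lborel C \<le> 2 * measure lborel E * measure lborel {x \<in> A. x + h \<in> C}"
proof (rule ccontr)
  assume contra: "\<not> ?thesis"
  define q where "q = measure lborel A * measure lborel C"
  have fin': "emeasure lborel {x \<in> A. x + h \<in> C} < \<infinity>" for h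
    by (rule le_less_trans[OF emeasure_mono fin(1)]) auto
  have bound: "emeasure lborel {x \<in> A. x + h \<in> C} \<le> ennreal (q / (2 * measure lborel E)) * indicator E h" for h
  proof (cases "h \<in> E")
    case True
    then have "2 * measure lborel E * measure lborel {x \<in> A. x + h \<in> C} < q"
      using contra by (auto simp: q_def not_le)
    then have "measure lborel {x \<in> A. x + h \<in> C} \<le> q / (2 * measure lborel E)"
      using pos by (simp add: field_simps)
    then show ?thesis
      using True fin'[of h] by (simp add: emeasure_eq_ennreal_measure ennreal_leI)
  next
    case False
    have "x + h \<notin> C" if "x \<in> A" for x
      using diff[OF that, of "x + h"] False by auto
    then have empty: "{x \<in> A. x + h \<in> C} = {}"
      by blast
    show ?thesis
      unfolding empty by simp
  qed
  have "ennreal q = (\<integral>\<^sup>+x. indicator A x * emeasure lborel C \<partial>lborel)"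
    using fin by (simp add: nn_integral_multc q_def ennreal_mult emeasure_eq_ennreal_measure)
  also have "\<dots> = (\<integral>\<^sup>+x. (\<integral>\<^sup>+h. indicator A x * indicator C (x + h) \<partial>lborel) \<partial>lborel)"
  proof (rule nn_integral_cong)
    fix x :: 'a
    have "emeasure lborel C = (\<integral>\<^sup>+y. indicator C y \<partial>distr lborel borel ((+) x))"
      by (simp add: lborel_distr_plus)
    also have "\<dots> = (\<integral>\<^sup>+h. indicator C (x + h) \<partial>lborel)"
      by (subst nn_integral_distr) auto
    finally show "indicator A x * emeasure lborel C = (\<integral>\<^sup>+h. indicator A x * indicator C (x + h) \<partial>lborel)"
      by (simp add: nn_integral_cmult)
  qed
  also have "\<dots> = (\<integral>\<^sup>+h. (\<integral>\<^sup>+x. indicator A x * indicator C (x + h) \<partial>lborel) \<partial>lborel)"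
    by (rule lborel_pair.Fubini') measurable
  also have "\<dots> = (\<integral>\<^sup>+h. emeasure lborel {x \<in> A. x + h \<in> C} \<partial>lborel)"
  proof (rule nn_integral_cong)
    fix h :: 'a
    have "(\<lambda>x. indicator A x * indicator C (x + h)) = (indicator {x \<in> A. x + h \<in> C} :: 'a \<Rightarrow> ennreal)"
      by (auto simp: fun_eq_iff split: split_indicator)
    then show "(\<integral>\<^sup>+x. indicator A x * indicator C (x + h) \<partial>lborel) = emeasure lborel {x \<in> A. x + h \<in> C}"
      by simp
  qed
  also have "\<dots> \<le> (\<integral>\<^sup>+h. ennreal (q / (2 * measure lborel E)) * indicator E h \<partial>lborel)"
    by (intro nn_integral_mono bound)
  also have "\<dots> = ennreal (q / 2)"
    using pos fin by (simp add: nn_integral_cmult_indicator emeasure_eq_ennreal_measure q_def flip: ennreal_mult)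
  finally show False
    using pos by (simp add: q_def)
qed

text \<open>The map taking each axis vector to \<open>v j\<close> differs from the identity by at
  most 1/100 in norm. It is therefore invertible, its inverse has norm at most 100/99, and 200/99 is
  below 3.\<close>

lemma near_axes_span:
  fixes v :: "'n::finite \<Rightarrow> real ^ 'n"
  assumes near: "\<And>j. norm (v j - axis j 1) \<le> 1 / (100 * real CARD('n))" and h: "norm h \<le> 2"
  shows "\<exists>t. h = (\<Sum>j\<in>UNIV. t j *\<^sub>R v j) \<and> (\<forall>j. \<bar>t j\<bar> \<le> 3)"
proof -
  define f where "f t = (\<Sum>j\<in>UNIV. (t $ j) *\<^sub>R v j)" for t :: "real ^ 'n"
  have "linear f"
    unfolding f_def by (rule linearI) (simp_all add: sum.distrib scaleR_add_left scaleR_sum_right)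
  have dist: "norm (f t - t) \<le> norm t / 100" for t
  proof -
    have "t = (\<Sum>j\<in>UNIV. (t $ j) *\<^sub>R axis j 1)"
      by (metis (no_types, lifting) basis_expansion scalar_mult_eq_scaleR sum.cong)
    then have "f t - t = (\<Sum>j\<in>UNIV. (t $ j) *\<^sub>R (v j - axis j 1))"
      unfolding f_def by (metis (no_types, lifting) scaleR_right_diff_distrib sum.cong sum_subtractf)
    also have "norm \<dots> \<le> (\<Sum>j\<in>(UNIV :: 'n set). norm t * (1 / (100 * real CARD('n))))"
      by (rule sum_norm_le, unfold norm_scaleR real_norm_def)
        (intro mult_mono near component_le_norm_cart, auto)
    finally show ?thesis
      by simp
  qed
  have norm_f: "norm t \<le> 100 / 99 * norm (f t)" for t
    using dist[of t] norm_triangle_ineq2[of t "f t"] by (simp add: norm_minus_commute)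
  have "inj f"
    unfolding linear_injective_0[OF \<open>linear f\<close>] by (metis norm_f norm_le_zero_iff norm_zero mult_zero_right)
  then have "surj f"
    using linear_injective_imp_surjective[OF \<open>linear f\<close> \<open>inj f\<close>] by simp
  then obtain t where t: "h = f t"
    by (metis surjD)
  have "\<bar>t $ j\<bar> \<le> 3" for j
    using component_le_norm_cart[of t j] norm_f[of t] h t by simp
  then show ?thesis
    using t unfolding f_def by blast
qed

lemma measure_translate:
  fixes S :: "'a::euclidean_space set"
  assumes "S \<in> sets borel"
  shows "measure lborel {x. x + a \<in> S} = measure lborel S"
proof -
  have "measure lborel S = measure (distr lborel borel ((+) a)) S"
    by (simp add: lborel_distr_plus)
  also have "\<dots> = measure lborel ((+) a -` S \<inter> space lborel)"
    using assms by (intro measure_distr) auto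
  also have "(+) a -` S \<inter> space lborel = {x. x + a \<in> S}"
    by (auto simp: add.commute)
  finally show ?thesis ..
qed

lemma fmeasurable_bounded_borel:
  fixes S :: "'a::euclidean_space set"
  shows "S \<in> sets borel \<Longrightarrow> bounded S \<Longrightarrow> S \<in> fmeasurable lborel"
  using emeasure_bounded_finite[of S] by (simp add: fmeasurable_def)

text \<open>Translation overlap between the two halves of the ball yields the share
  \<open>(\<beta> / 2)\<^sup>2 / (2 * \<gamma>)\<close> for a single vector \<open>h\<close>.
  Splitting \<open>h\<close> along the \<open>v j\<close> and keeping the best step divides it by
  \<open>N\<close>.\<close>

lemma exists_sign_change_direction:
  fixes v :: "'n::finite \<Rightarrow> real ^ 'n"
  defines "N \<equiv> real CARD('n)"
  assumes unit: "\<And>j. norm (v j) = 1"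
    and near: "\<And>j. norm (v j - axis j 1) \<le> 1 / (100 * N)"
    and S [measurable]: "S \<in> sets borel"
    and half: "measure lborel (ball p 1 \<inter> S) = measure lborel (ball p 1) / 2"
  shows "\<exists>j t. \<bar>t\<bar> \<le> 3 \<and> (measure lborel (ball (0 :: real ^ 'n) 1))\<^sup>2 / (8 * N * measure lborel (ball (0 :: real ^ 'n) 2))
    \<le> measure lborel {y \<in> ball p (1 + 3 * N). (y \<in> S) \<noteq> (y + t *\<^sub>R v j \<in> S)}"
proof -
  define \<beta> where "\<beta> = measure lborel (ball (0 :: real ^ 'n) 1)"
  define \<gamma> where "\<gamma> = measure lborel (ball (0 :: real ^ 'n) 2)"
  have ball_p: "measure lborel (ball p 1) = \<beta>"
    by (simp add: \<beta>_def content_ball)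
  have "\<beta> > 0" "\<gamma> > 0"
    by (simp_all add: \<beta>_def \<gamma>_def content_ball_pos)
  have "N > 0"
    by (simp add: N_def)
  have meas: "{x \<in> ball p r. Q x} \<in> fmeasurable lborel" if "{x. Q x} \<in> sets borel" for r Q
  proof -
    have "{x \<in> ball p r. Q x} = ball p r \<inter> {x. Q x}"
      by auto
    also have "\<dots> \<in> fmeasurable lborel"
      using that by (intro fmeasurable_bounded_borel) (auto intro: bounded_subset[OF bounded_ball])
    finally show ?thesis .
  qed
  have "measure lborel (ball p 1 - S) = \<beta> / 2"
  proof -
    have "measure lborel (ball p 1 - S) = measure lborel (ball p 1) - measure lborel (ball p 1 \<inter> S)"
      using emeasure_lborel_ball_finite[of p 1]
      by (subst measure_Diff[symmetric]) (auto simp: Diff_Int)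
    then show ?thesis
      using half ball_p by simp
  qed
  note C_measure = this
  have "\<exists>h\<in>ball 0 2. measure lborel (ball p 1 \<inter> S) * measure lborel (ball p 1 - S)
      \<le> 2 * measure lborel (ball (0 :: real ^ 'n) 2) * measure lborel {x \<in> ball p 1 \<inter> S. x + h \<in> ball p 1 - S}"
  proof (rule exists_translation_overlap)
    show "emeasure lborel (ball p 1 \<inter> S) < \<infinity>"
      by (rule emeasure_bounded_finite) (auto intro: bounded_subset[OF bounded_ball])
    show "emeasure lborel (ball p 1 - S) < \<infinity>"
      by (rule emeasure_bounded_finite) (auto intro: bounded_subset[OF bounded_ball])
    show "emeasure lborel (ball (0 :: real ^ 'n) 2) < \<infinity>"
      by (rule emeasure_bounded_finite) (auto intro: bounded_subset[OF bounded_ball])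
    show "0 < measure lborel (ball p 1 \<inter> S)" "0 < measure lborel (ball p 1 - S)"
      "0 < measure lborel (ball (0 :: real ^ 'n) 2)"
      using \<open>\<beta> > 0\<close> \<open>\<gamma> > 0\<close> by (auto simp: half ball_p C_measure \<gamma>_def)
    show "y - x \<in> ball 0 2" if "x \<in> ball p 1 \<inter> S" "y \<in> ball p 1 - S" for x y
      using that dist_triangle2[of x y p] by (simp add: dist_norm norm_minus_commute)
  qed auto
  then obtain h where "norm h < 2"
    and h: "(\<beta> / 2) * (\<beta> / 2) \<le> 2 * \<gamma> * measure lborel {x \<in> ball p 1 \<inter> S. x + h \<in> ball p 1 - S}"
    unfolding half ball_p C_measure \<gamma>_def by auto
  obtain t where t: "h = (\<Sum>j\<in>UNIV. t j *\<^sub>R v j)" "\<And>j. \<bar>t j\<bar> \<le> 3"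
    using near_axes_span[of v h] near \<open>norm h < 2\<close> unfolding N_def by force
  define T where "T J = (\<Sum>j\<in>J. t j *\<^sub>R v j)" for J
  define c where "c j = measure lborel {y \<in> ball p (1 + 3 * N). (y \<in> S) \<noteq> (y + t j *\<^sub>R v j \<in> S)}" for j
  \<comment> \<open>Partial walks have length at most \<open>3 * N\<close>, whence the radius
    \<open>1 + 3 * N\<close>.\<close>
  have norm_T: "norm (T J) \<le> 3 * N" for J
  proof -
    have "norm (T J) \<le> (\<Sum>j\<in>J. 3)"
      unfolding T_def by (rule sum_norm_le) (simp add: unit t)
    also have "\<dots> \<le> 3 * N"
      by (simp add: N_def card_mono)
    finally show ?thesis .
  qed
  have path: "measure lborel {x \<in> ball p 1. (x \<in> S) \<noteq> (x + T J \<in> S)} \<le> (\<Sum>j\<in>J. c j)" if "finite J" for J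
    using that
  proof (induction J rule: finite_induct)
    case empty
    then show ?case
      by (simp add: T_def)
  next
    case (insert j J)
    have T_insert: "T (insert j J) = T J + t j *\<^sub>R v j"
      using insert by (simp add: T_def add.commute)
    \<comment> \<open>\<open>M\<close> consists of those positions \<open>x + T J\<close>, with
      \<open>x\<close> in the unit ball, from which the step along \<open>v j\<close> changes
      sides.\<close>
    define M where "M = {y. (y \<in> S) \<noteq> (y + t j *\<^sub>R v j \<in> S) \<and> dist p (y - T J) < 1}"
    have [measurable]: "M \<in> sets borel"
      unfolding M_def by measurable
    have M_sub: "M \<subseteq> {y \<in> ball p (1 + 3 * N). (y \<in> S) \<noteq> (y + t j *\<^sub>R v j \<in> S)}"
    proof -
      have "dist p y < 1 + 3 * N" if "dist p (y - T J) < 1" for y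
        using norm_triangle_ineq4[of "p - (y - T J)" "T J"] norm_T[of J] that by (simp add: dist_norm)
      then show ?thesis
        by (auto simp: M_def)
    qed
    have "measure lborel {x \<in> ball p 1. (x \<in> S) \<noteq> (x + T (insert j J) \<in> S)}
        \<le> measure lborel ({x \<in> ball p 1. (x \<in> S) \<noteq> (x + T J \<in> S)} \<union> {x. x + T J \<in> M})"
    proof (rule measure_mono_fmeasurable)
      show "{x \<in> ball p 1. (x \<in> S) \<noteq> (x + T (insert j J) \<in> S)}
          \<subseteq> {x \<in> ball p 1. (x \<in> S) \<noteq> (x + T J \<in> S)} \<union> {x. x + T J \<in> M}"
        by (auto simp: M_def T_insert add.assoc)
      have "{x. x + T J \<in> M} \<subseteq> ball p 1"
        by (auto simp: M_def)
      then have "{x. x + T J \<in> M} \<in> fmeasurable lborel"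
        by (intro fmeasurable_bounded_borel bounded_subset[OF bounded_ball]) measurable
      then show "{x \<in> ball p 1. (x \<in> S) \<noteq> (x + T J \<in> S)} \<union> {x. x + T J \<in> M} \<in> fmeasurable lborel"
        by (intro fmeasurable.Un meas) measurable
    qed (auto intro!: fmeasurableD meas)
    also have "\<dots> \<le> measure lborel {x \<in> ball p 1. (x \<in> S) \<noteq> (x + T J \<in> S)} + measure lborel {x. x + T J \<in> M}"
      by (rule measure_Un_le) measurable
    also have "measure lborel {x. x + T J \<in> M} = measure lborel M"
      by (rule measure_translate) measurable
    also have "\<dots> \<le> c j"
      unfolding c_def
    proof (rule measure_mono_fmeasurable[OF M_sub])
      show "{y \<in> ball p (1 + 3 * N). (y \<in> S) \<noteq> (y + t j *\<^sub>R v j \<in> S)} \<in> fmeasurable lborel"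
        by (rule meas) measurable
    qed simp
    finally show ?case
      using insert by simp
  qed
  have "\<beta>\<^sup>2 / (8 * \<gamma>) \<le> measure lborel {x \<in> ball p 1 \<inter> S. x + h \<in> ball p 1 - S}"
    using h \<open>\<gamma> > 0\<close> by (simp add: field_simps power2_eq_square)
  also have "\<dots> \<le> measure lborel {x \<in> ball p 1. (x \<in> S) \<noteq> (x + T UNIV \<in> S)}"
  proof (rule measure_mono_fmeasurable)
    show "{x \<in> ball p 1. (x \<in> S) \<noteq> (x + T UNIV \<in> S)} \<in> fmeasurable lborel"
      by (rule meas) measurable
  qed (auto simp: T_def t(1))
  also have "\<dots> \<le> (\<Sum>j\<in>UNIV. c j)"
    by (rule path) simp
  finally have sum: "\<beta>\<^sup>2 / (8 * \<gamma>) \<le> (\<Sum>j\<in>UNIV. c j)" .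
  have "\<exists>j. \<beta>\<^sup>2 / (8 * N * \<gamma>) \<le> c j"
  proof (rule ccontr)
    assume "\<not> ?thesis"
    then have "(\<Sum>j\<in>UNIV. c j) < (\<Sum>j\<in>(UNIV :: 'n set). \<beta>\<^sup>2 / (8 * N * \<gamma>))"
      by (intro sum_strict_mono) (auto simp: not_le)
    also have "\<dots> = \<beta>\<^sup>2 / (8 * \<gamma>)"
      using \<open>N > 0\<close> by (simp add: N_def)
    finally show False
      using sum by simp
  qed
  then show ?thesis
    using t(2) unfolding c_def \<beta>_def \<gamma>_def by blast
qed

section \<open>Counting cut balls along a tube\<close>

lemma zero_between_sign_change:
  fixes g :: "real \<Rightarrow> real"
  assumes "continuous_on UNIV g" "(0 < g a) \<noteq> (0 < g b)"
  shows "\<exists>t\<in>closed_segment a b. g t = 0"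
proof -
  have "connected (g ` closed_segment a b)"
    using assms(1) by (intro connected_continuous_image) (auto intro: continuous_on_subset)
  moreover have "g a \<in> g ` closed_segment a b" "g b \<in> g ` closed_segment a b"
    by auto
  moreover have "g a \<le> 0 \<and> 0 \<le> g b \<or> g b \<le> 0 \<and> 0 \<le> g a"
    using assms(2) by auto
  ultimately have "0 \<in> g ` closed_segment a b"
    by (meson connectedD_interval)
  then show ?thesis
    by auto
qed

text \<open>Shifted by \<open>- k p\<close> along \<open>v\<close>, the sets of sign changes all lie
  in one ball. A point in several shifted sets yields distinct zeros of \<open>P\<close> on its line
  parallel to \<open>v\<close>, so at most \<open>D\<close> of them overlap.\<close>

lemma tube_bound:
  fixes v b :: "'a::euclidean_space" and \<tau> :: "'a \<Rightarrow> real"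
  assumes "finite F" and P: "poly_on_lines D P" and [measurable]: "P \<in> borel_measurable borel"
    and unit: "norm v = 1"
    and near: "\<And>p. p \<in> F \<Longrightarrow> \<exists>s. norm (p - (b + s *\<^sub>R v)) \<le> 1"
    and sep: "\<And>p q. p \<in> F \<Longrightarrow> q \<in> F \<Longrightarrow> p \<noteq> q \<Longrightarrow> 2 * \<rho> \<le> dist p q"
    and \<tau>: "\<And>p. p \<in> F \<Longrightarrow> \<bar>\<tau> p\<bar> \<le> 3"
    and cut: "\<And>p. p \<in> F \<Longrightarrow> c \<le> measure lborel {y \<in> ball p \<rho>. (0 < P y) \<noteq> (0 < P (y + \<tau> p *\<^sub>R v))}"
  shows "real (card F) * c \<le> real D * measure lborel (ball (0 :: 'a) (\<rho> + 8))"
proof -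
  obtain s where s: "\<And>p. p \<in> F \<Longrightarrow> norm (p - (b + s p *\<^sub>R v)) \<le> 1"
    using near by metis
  define k where "k p = 7 * real_of_int \<lfloor>s p / 7\<rfloor>" for p
  (* The sign change belonging to p lies within 3 of k p along the line, and these intervals are
     disjoint for distinct multiples of 7, so that the zeros found for distinct values of k differ. *)
  have k: "\<bar>s p - k p\<bar> \<le> 7" for p
    unfolding k_def by linarith
  define E where "E p = {y \<in> ball p \<rho>. (0 < P y) \<noteq> (0 < P (y + \<tau> p *\<^sub>R v))}" for p
  have E_borel [measurable]: "E p \<in> sets borel" for p
  proof -
    have "E p = ball p \<rho> \<inter> {y. (0 < P y) \<noteq> (0 < P (y + \<tau> p *\<^sub>R v))}"
      by (auto simp: E_def)
    also have "\<dots> \<in> sets borel"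
      by measurable
    finally show ?thesis .
  qed
  define S where "S p = {x. x + k p *\<^sub>R v \<in> E p}" for p
  have "real (card F) * c = (\<Sum>p\<in>F. c)"
    by simp
  also have "\<dots> \<le> (\<Sum>p\<in>F. measure lborel (S p))"
    using cut[folded E_def] by (intro sum_mono) (simp add: S_def measure_translate E_borel)
  also have "\<dots> \<le> real D * measure lborel (ball b (\<rho> + 8))"
  proof (rule sum_measure_le_multiplicity[OF \<open>finite F\<close>])
    show "S p \<in> sets lborel" for p
    proof -
      have "S p = {x \<in> space borel. x + k p *\<^sub>R v \<in> E p}"
        by (simp add: S_def)
      also have "\<dots> \<in> sets borel"
        by measurable
      finally show ?thesis
        by simp
    qed
    \<comment> \<open>The 8 is 1 for the distance of \<open>p\<close> from the core plus 7 for
      rounding \<open>s p\<close> to \<open>k p\<close>.\<close>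
    show "S p \<subseteq> ball b (\<rho> + 8)" if "p \<in> F" for p
    proof
      fix x assume "x \<in> S p"
      then have "norm (x + k p *\<^sub>R v - p) < \<rho>"
        by (simp add: S_def E_def dist_norm norm_minus_commute)
      moreover have "x - b = (x + k p *\<^sub>R v - p) + ((p - (b + s p *\<^sub>R v)) + (s p - k p) *\<^sub>R v)"
        by (simp add: algebra_simps)
      then have "norm (x - b) \<le> norm (x + k p *\<^sub>R v - p) + (norm (p - (b + s p *\<^sub>R v)) + norm ((s p - k p) *\<^sub>R v))"
        by (metis (no_types, lifting) add_left_mono norm_triangle_ineq order_trans)
      moreover have "norm ((s p - k p) *\<^sub>R v) \<le> 7"
        using k[of p] by (simp add: unit)
      ultimately show "x \<in> ball b (\<rho> + 8)"
        using s[OF that] by (simp add: dist_norm norm_minus_commute)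
    qed
    show "card {p \<in> F. x \<in> S p} \<le> D" for x
    proof (cases "{p \<in> F. x \<in> S p} = {}")
      case False
      define g where "g t = P (x + t *\<^sub>R v)" for t
      obtain q where q: "\<And>t. g t = poly q t"
        using P unfolding poly_on_lines_def g_def by metis
      have cont: "continuous_on UNIV g"
        unfolding q[abs_def] by (intro continuous_intros)
      have change: "(0 < g (k p)) \<noteq> (0 < g (k p + \<tau> p))" if "x \<in> S p" for p
        using that by (simp add: S_def E_def g_def scaleR_add_left add.assoc)
      have "\<exists>t. g t = 0 \<and> \<bar>t - k p\<bar> \<le> 3" if p: "p \<in> F" "x \<in> S p" for p
      proof -
        obtain t where "t \<in> closed_segment (k p) (k p + \<tau> p)" "g t = 0"
          using zero_between_sign_change[OF cont change[OF p(2)]] by blast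
        then show ?thesis
          using \<tau>[OF p(1)] by (intro exI[of _ t]) (auto simp: closed_segment_eq_real_ivl split: if_splits)
      qed
      then obtain r where r: "\<And>p. p \<in> F \<Longrightarrow> x \<in> S p \<Longrightarrow> g (r p) = 0 \<and> \<bar>r p - k p\<bar> \<le> 3"
        by metis
      \<comment> \<open>A sign change excludes that \<open>P\<close> vanishes along the whole
        line.\<close>
      have "\<exists>t0. g t0 \<noteq> 0"
        using False change by fastforce
      then obtain t0 where "P (x + t0 *\<^sub>R v) \<noteq> 0"
        unfolding g_def by blast
      note zeros = card_zeros_on_line[OF P this]
      have "card {p \<in> F. x \<in> S p} \<le> card {t. P (x + t *\<^sub>R v) = 0}"
      proof (rule card_inj_on_le[OF _ _ zeros(1)])
        show "r ` {p \<in> F. x \<in> S p} \<subseteq> {t. P (x + t *\<^sub>R v) = 0}"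
          using r by (auto simp: g_def)
        show "inj_on r {p \<in> F. x \<in> S p}"
        proof (rule inj_onI, rule ccontr)
          fix p q assume pq: "p \<in> {p \<in> F. x \<in> S p}" "q \<in> {p \<in> F. x \<in> S p}" "r p = r q" "p \<noteq> q"
          then have "\<bar>k p - k q\<bar> \<le> 6"
            using r[of p] r[of q] by auto
          then have "\<bar>real_of_int (\<lfloor>s p / 7\<rfloor> - \<lfloor>s q / 7\<rfloor>)\<bar> < 1"
            unfolding k_def by simp
          then have "\<bar>\<lfloor>s p / 7\<rfloor> - \<lfloor>s q / 7\<rfloor>\<bar> < 1"
            by (simp only: of_int_abs[symmetric] of_int_less_1_iff)
          \<comment> \<open>Equal shifts would place one point in the balls around both
            \<open>p\<close> and \<open>q\<close>, against their separation.\<close>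
          then have "k p = k q"
            unfolding k_def by simp
          then have "dist p (x + k p *\<^sub>R v) < \<rho>" "dist q (x + k p *\<^sub>R v) < \<rho>"
            using pq by (auto simp: S_def E_def)
          then have "dist p q < 2 * \<rho>"
            using dist_triangle2[of p q "x + k p *\<^sub>R v"] by linarith
          then show False
            using sep[of p q] pq by auto
        qed
      qed
      then show ?thesis
        using zeros(2) by linarith
    next
      case True
      then show ?thesis
        by (simp only: card.empty)
    qed
  qed (use emeasure_lborel_ball_finite in auto)
  also have "measure lborel (ball b (\<rho> + 8)) = measure lborel (ball (0 :: 'a) (\<rho> + 8))"
    by (cases "0 \<le> \<rho> + 8") (simp_all add: content_ball ball_empty)
  finally show ?thesis .
qed

section \<open>Polynomials of bounded degree in each variable\<close>

lemma poly_on_lines_const: "poly_on_lines 0 (\<lambda>x. a)"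
  unfolding poly_on_lines_def by (intro allI exI[of _ "[:a:]"]) simp

lemma poly_on_lines_mult:
  assumes "poly_on_lines D P" "poly_on_lines E Q"
  shows "poly_on_lines (D + E) (\<lambda>x. P x * Q x)"
  unfolding poly_on_lines_def
proof (intro allI)
  fix x v
  obtain p q where "degree p \<le> D" "\<forall>t. P (x + t *\<^sub>R v) = poly p t"
    "degree q \<le> E" "\<forall>t. Q (x + t *\<^sub>R v) = poly q t"
    using assms unfolding poly_on_lines_def by metis
  then show "\<exists>r. degree r \<le> D + E \<and> (\<forall>t. P (x + t *\<^sub>R v) * Q (x + t *\<^sub>R v) = poly r t)"
    by (intro exI[of _ "p * q"]) (auto intro: order_trans[OF degree_mult_le])
qed

lemma poly_on_lines_prod:
  assumes "finite I" "\<And>i. i \<in> I \<Longrightarrow> poly_on_lines (D i) (P i)"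
  shows "poly_on_lines (\<Sum>i\<in>I. D i) (\<lambda>x. \<Prod>i\<in>I. P i x)"
  using assms by (induction I rule: finite_induct) (auto intro: poly_on_lines_const poly_on_lines_mult)

lemma poly_on_lines_add:
  assumes "poly_on_lines D P" "poly_on_lines D Q"
  shows "poly_on_lines D (\<lambda>x. P x + Q x)"
  unfolding poly_on_lines_def
proof (intro allI)
  fix x v
  obtain p q where "degree p \<le> D" "\<forall>t. P (x + t *\<^sub>R v) = poly p t"
    "degree q \<le> D" "\<forall>t. Q (x + t *\<^sub>R v) = poly q t"
    using assms unfolding poly_on_lines_def by metis
  then show "\<exists>r. degree r \<le> D \<and> (\<forall>t. P (x + t *\<^sub>R v) + Q (x + t *\<^sub>R v) = poly r t)"
    by (intro exI[of _ "p + q"]) (auto intro: degree_add_le)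
qed

lemma poly_on_lines_mono: "poly_on_lines D P \<Longrightarrow> D \<le> E \<Longrightarrow> poly_on_lines E P"
  unfolding poly_on_lines_def by (meson order_trans)

lemma poly_on_lines_sum:
  assumes "finite I" "\<And>i. i \<in> I \<Longrightarrow> poly_on_lines D (P i)"
  shows "poly_on_lines D (\<lambda>x. \<Sum>i\<in>I. P i x)"
  using assms
  by (induction I rule: finite_induct) (auto intro: poly_on_lines_add poly_on_lines_mono[OF poly_on_lines_const])

lemma poly_on_lines_coord: "poly_on_lines 1 (\<lambda>x :: real ^ 'n. x $ i - a)"
  unfolding poly_on_lines_def
proof (intro allI)
  fix x v :: "real ^ 'n"
  show "\<exists>q. degree q \<le> 1 \<and> (\<forall>t. (x + t *\<^sub>R v) $ i - a = poly q t)"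
    by (intro exI[of _ "[:x $ i - a, v $ i:]"]) auto
qed

text \<open>For \<open>g\<close> in the grid \<open>{..d}\<close> to the power
  \<open>CARD('n)\<close>, this is the unnormalised Lagrange polynomial that vanishes at every grid
  point except \<open>g\<close>.\<close>

definition grid_poly :: "nat \<Rightarrow> ('n::finite \<Rightarrow> nat) \<Rightarrow> real ^ 'n \<Rightarrow> real" where
  "grid_poly d g x = (\<Prod>i\<in>UNIV. \<Prod>m\<in>{..d} - {g i}. x $ i - real m)"

lemma poly_on_lines_grid_poly:
  fixes g :: "'n::finite \<Rightarrow> nat"
  assumes "\<And>i. g i \<le> d"
  shows "poly_on_lines (CARD('n) * d) (grid_poly d g)"
proof -
  have "poly_on_lines (\<Sum>i\<in>(UNIV :: 'n set). \<Sum>m\<in>{..d} - {g i}. 1) (grid_poly d g)"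
    unfolding grid_poly_def[abs_def] by (intro poly_on_lines_prod poly_on_lines_coord) auto
  then show ?thesis
    using assms by (simp add: card_Diff_singleton)
qed

lemma grid_poly_eq_0_iff:
  fixes f g :: "'n::finite \<Rightarrow> nat"
  assumes "\<And>i. f i \<le> d"
  shows "grid_poly d g (\<chi> i. real (f i)) = 0 \<longleftrightarrow> f \<noteq> g"
  using assms by (auto simp: grid_poly_def fun_eq_iff)

lemma borel_measurable_grid_poly [measurable]: "grid_poly d g \<in> borel_measurable borel"
  unfolding grid_poly_def[abs_def] by (intro borel_measurable_continuous_onI continuous_intros)

text \<open>The grid supplies \<open>card F + 1\<close> polynomials. Evaluating at grid points shows
  that their nontrivial combinations are not identically zero, hence have null zero sets, as
  \<open>ham_sandwich\<close> demands.\<close>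

lemma exists_bisecting_poly:
  fixes F :: "(real ^ 'n) set"
  assumes "finite F" "card F < (d + 1) ^ CARD('n)"
  obtains P where "poly_on_lines (CARD('n) * d) P" "P \<in> borel_measurable borel"
    "\<And>p. p \<in> F \<Longrightarrow> measure lborel {x \<in> ball p 1. 0 < P x} = measure lborel (ball p 1) / 2"
proof -
  define V where "V = card F"
  obtain p where p: "bij_betw p {..<V} F"
    using ex_bij_betw_nat_finite[OF \<open>finite F\<close>] unfolding V_def atLeast0LessThan by blast
  define G where "G = PiE (UNIV :: 'n set) (\<lambda>_. {..d})"
  have "finite G" "card G = (d + 1) ^ CARD('n)"
    unfolding G_def by (simp_all add: finite_PiE card_PiE)
  then obtain H where H: "H \<subseteq> G" "card H = Suc V" "finite H"
    using obtain_subset_with_card_n[of "Suc V" G] assms(2) unfolding V_def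
    by (metis Suc_leI finite_subset)
  then obtain g where g: "bij_betw g {..V} H"
    using ex_bij_betw_nat_finite[OF H(3)] by (auto simp: atLeast0LessThan lessThan_Suc_atMost)
  have g_le: "g k i \<le> d" if "k \<le> V" for k i
    using bij_betwE[OF g] H(1) that unfolding G_def by auto
  define P where "P c x = (\<Sum>k\<le>V. c k * grid_poly d (g k) x)" for c x
  have P_lines: "poly_on_lines (CARD('n) * d) (P c)" for c
  proof -
    have "poly_on_lines (0 + CARD('n) * d) (\<lambda>x. c k * grid_poly d (g k) x)" if "k \<le> V" for k
      using that g_le by (intro poly_on_lines_mult poly_on_lines_const poly_on_lines_grid_poly) auto
    then show ?thesis
      unfolding P_def[abs_def] by (intro poly_on_lines_sum) auto
  qed
  have P_meas: "P c \<in> borel_measurable borel" for c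
    unfolding P_def[abs_def] by measurable
  have null: "{x. P c x = 0} \<in> null_sets lborel" if "\<exists>k\<le>V. c k \<noteq> 0" for c
  proof -
    obtain l where l: "l \<le> V" "c l \<noteq> 0"
      using \<open>\<exists>k\<le>V. c k \<noteq> 0\<close> by blast
    define w :: "real ^ 'n" where "w = (\<chi> i. real (g l i))"
    have "grid_poly d (g k) w = 0 \<longleftrightarrow> k \<noteq> l" if "k \<le> V" for k
    proof -
      have "g l = g k \<longleftrightarrow> l = k"
        using bij_betw_imp_inj_on[OF g] that l(1) by (auto dest: inj_onD)
      then show ?thesis
        unfolding w_def using grid_poly_eq_0_iff[of "g l" d "g k"] g_le[OF l(1)] by auto
    qed
    note eval = this
    have "P c w = (\<Sum>k\<le>V. if k = l then c l * grid_poly d (g l) w else 0)"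
      unfolding P_def by (rule sum.cong) (use eval in auto)
    then have "P c w \<noteq> 0"
      using l eval by simp
    then show ?thesis
      by (rule null_sets_zeros[OF P_lines P_meas])
  qed
  have "\<exists>c. (\<exists>k\<le>V. c k \<noteq> 0) \<and>
      (\<forall>j<V. measure lborel {x \<in> ball (p j) 1. 0 < P c x} = measure lborel (ball (p j) 1) / 2)"
    unfolding P_def
    by (rule ham_sandwich) (use null in \<open>auto simp: P_def emeasure_lborel_ball_finite[unfolded infinity_ennreal_def]\<close>)
  then obtain c where c: "\<And>j. j < V \<Longrightarrow> measure lborel {x \<in> ball (p j) 1. 0 < P c x} = measure lborel (ball (p j) 1) / 2"
    by blast
  show ?thesis
  proof (rule that[OF P_lines P_meas])
    fix x assume "x \<in> F"
    then obtain j where "j < V" "x = p j"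
      using p by (auto simp: bij_betw_def)
    then show "measure lborel {y \<in> ball x 1. 0 < P c y} = measure lborel (ball x 1) / 2"
      using c by simp
  qed
qed

section \<open>The multilinear Kakeya bound\<close>

text \<open>Summing \<open>tube_bound\<close> over the tubes gives \<open>V \<le> K * A * d\<close>;
  raise this to the power \<open>n\<close>, use \<open>d ^ n \<le> V\<close> and cancel one
  \<open>V\<close>. The radius \<open>9 + 3 * N\<close> in \<open>K\<close> is
  \<open>(1 + 3 * N) + 8\<close>.\<close>

lemma separated_card_bound:
  fixes v b :: "'n::finite \<Rightarrow> nat \<Rightarrow> real ^ 'n"
  defines "N \<equiv> real CARD('n)"
  defines "K \<equiv> 8 * N ^ 3 * measure lborel (ball (0 :: real ^ 'n) 2)
    * measure lborel (ball (0 :: real ^ 'n) (9 + 3 * N)) / (measure lborel (ball (0 :: real ^ 'n) 1))\<^sup>2"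
  assumes two: "CARD('n) \<ge> 2"
    and unit: "\<And>j a. a \<in> {1..A} \<Longrightarrow> norm (v j a) = 1"
    and near: "\<And>j a. a \<in> {1..A} \<Longrightarrow> norm (v j a - axis j 1) \<le> 1 / (100 * N)"
    and "finite F"
    and sep: "\<And>p q. p \<in> F \<Longrightarrow> q \<in> F \<Longrightarrow> p \<noteq> q \<Longrightarrow> 2 * (1 + 3 * N) \<le> dist p q"
    and tubes: "\<And>p j. p \<in> F \<Longrightarrow> \<exists>a\<in>{1..A}. \<exists>s. norm (p - (b j a + s *\<^sub>R v j a)) \<le> 1"
  shows "real (card F) ^ (CARD('n) - 1) \<le> (K * real A) ^ CARD('n)"
proof (cases "F = {}")
  case True
  then show ?thesis
    using two by (simp add: K_def N_def zero_power)
next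
  case False
  define n where "n = CARD('n)"
  have "n > 0"
    by (simp add: n_def)
  define V where "V = card F"
  have "V > 0"
    using False \<open>finite F\<close> by (simp add: V_def card_gt_0_iff)
  \<comment> \<open>With \<open>m = d + 1\<close>, minimality gives both
    \<open>V < (d + 1) ^ n\<close>, for bisecting, and \<open>d ^ n \<le> V\<close>, for the last
    estimate.\<close>
  define m where "m = (LEAST m. V < m ^ n)"
  have "V < (V + 1) ^ n"
  proof -
    have "(V + 1) ^ 1 \<le> (V + 1) ^ n"
      using \<open>n > 0\<close> by (intro power_increasing) auto
    then show ?thesis
      by simp
  qed
  then have m: "V < m ^ n"
    unfolding m_def by (rule LeastI)
  then have "m > 0"
    using \<open>n > 0\<close> by (cases "m = 0") (auto simp: zero_power)
  then obtain d where d: "m = d + 1"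
    by (metis Suc_eq_plus1 gr0_conv_Suc)
  have d_le: "d ^ n \<le> V"
    using not_less_Least[of d "\<lambda>m. V < m ^ n"] d by (simp add: m_def)
  obtain P where P: "poly_on_lines (n * d) P" and [measurable]: "P \<in> borel_measurable borel"
    and half: "\<And>p. p \<in> F \<Longrightarrow> measure lborel {x \<in> ball p 1. 0 < P x} = measure lborel (ball p 1) / 2"
    using exists_bisecting_poly[OF \<open>finite F\<close>, of d] m unfolding d V_def n_def by blast
  obtain a where a: "\<And>p j. p \<in> F \<Longrightarrow> a p j \<in> {1..A} \<and> (\<exists>s. norm (p - (b j (a p j) + s *\<^sub>R v j (a p j))) \<le> 1)"
    using tubes by metis
  define c where "c = (measure lborel (ball (0 :: real ^ 'n) 1))\<^sup>2 / (8 * N * measure lborel (ball (0 :: real ^ 'n) 2))"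
  define cut where "cut p j t \<longleftrightarrow> \<bar>t\<bar> \<le> 3 \<and>
    c \<le> measure lborel {y \<in> ball p (1 + 3 * N). (0 < P y) \<noteq> (0 < P (y + t *\<^sub>R v j (a p j)))}" for p j t
  have "\<exists>j t. cut p j t" if "p \<in> F" for p
  proof -
    have "{x. 0 < P x} \<in> sets borel"
      by measurable
    moreover have "ball p 1 \<inter> {x. 0 < P x} = {x \<in> ball p 1. 0 < P x}"
      by auto
    ultimately show ?thesis
      using exists_sign_change_direction[of "\<lambda>j. v j (a p j)" "{x. 0 < P x}" p] unit near a that half
      unfolding cut_def c_def N_def by simp
  qed
  then obtain j \<tau> where j: "\<And>p. p \<in> F \<Longrightarrow> cut p (j p) (\<tau> p)"
    by metis
  define W where "W = measure lborel (ball (0 :: real ^ 'n) (9 + 3 * N))"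
  have tube: "real (card {p \<in> F. j p = i \<and> a p (j p) = k}) * c \<le> real (n * d) * W" if "k \<in> {1..A}" for i k
  proof -
    have "real (card {p \<in> F. j p = i \<and> a p (j p) = k}) * c
        \<le> real (n * d) * measure lborel (ball (0 :: real ^ 'n) ((1 + 3 * N) + 8))"
    proof (rule tube_bound[where v="v i k" and b="b i k" and \<tau>=\<tau>, OF _ P])
      show "\<exists>s. norm (p - (b i k + s *\<^sub>R v i k)) \<le> 1" if "p \<in> {p \<in> F. j p = i \<and> a p (j p) = k}" for p
        using a[of p i] that by auto
      show "c \<le> measure lborel {y \<in> ball p (1 + 3 * N). (0 < P y) \<noteq> (0 < P (y + \<tau> p *\<^sub>R v i k))}"
        if "p \<in> {p \<in> F. j p = i \<and> a p (j p) = k}" for p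
        using j[of p] that by (auto simp: cut_def)
      show "\<bar>\<tau> p\<bar> \<le> 3" if "p \<in> {p \<in> F. j p = i \<and> a p (j p) = k}" for p
        using j[of p] that by (simp add: cut_def)
    qed (use \<open>finite F\<close> unit \<open>k \<in> {1..A}\<close> sep in auto)
    then show ?thesis
      by (simp add: W_def algebra_simps)
  qed
  have F_eq: "F = (\<Union>i\<in>UNIV. \<Union>k\<in>{1..A}. {p \<in> F. j p = i \<and> a p (j p) = k})"
    using a by auto
  have "V = card (\<Union>i\<in>UNIV. \<Union>k\<in>{1..A}. {p \<in> F. j p = i \<and> a p (j p) = k})"
    unfolding V_def by (rule arg_cong[OF F_eq])
  also have "\<dots> \<le> (\<Sum>i\<in>UNIV. card (\<Union>k\<in>{1..A}. {p \<in> F. j p = i \<and> a p (j p) = k}))"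
    by (rule card_UN_le) simp
  also have "\<dots> \<le> (\<Sum>i\<in>UNIV. \<Sum>k\<in>{1..A}. card {p \<in> F. j p = i \<and> a p (j p) = k})"
    by (intro sum_mono card_UN_le) auto
  finally have "real V * c \<le> real (\<Sum>i\<in>UNIV. \<Sum>k\<in>{1..A}. card {p \<in> F. j p = i \<and> a p (j p) = k}) * c"
    by (intro mult_right_mono) (auto simp: c_def N_def simp flip: of_nat_sum)
  also have "\<dots> = (\<Sum>i\<in>UNIV. \<Sum>k\<in>{1..A}. real (card {p \<in> F. j p = i \<and> a p (j p) = k}) * c)"
    by (simp add: sum_distrib_right)
  also have "\<dots> \<le> (\<Sum>i\<in>(UNIV :: 'n set). \<Sum>k\<in>{1..A}. real (n * d) * W)"
    by (intro sum_mono tube)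
  \<comment> \<open>One factor \<open>N\<close> counts the directions, the other comes from the
    degree \<open>n * d\<close>.\<close>
  also have "\<dots> = N ^ 2 * real A * real d * W"
    by (simp add: N_def n_def power2_eq_square)
  finally have "real V * c \<le> N ^ 2 * real A * real d * W" .
  moreover have "c > 0"
    by (simp add: c_def N_def content_ball_pos)
  ultimately have "real V \<le> N ^ 2 * real A * real d * W / c"
    by (simp add: field_simps)
  also have "\<dots> = K * real A * real d"
    by (simp add: K_def c_def W_def power2_eq_square power3_eq_cube field_simps)
  finally have "real V ^ n \<le> (K * real A * real d) ^ n"
    by (intro power_mono) auto
  also have "\<dots> \<le> (K * real A) ^ n * real V"
  proof -
    have "real d ^ n \<le> real V"
      using d_le by (metis of_nat_le_iff of_nat_power)
    then show ?thesis
      unfolding power_mult_distrib by (intro mult_left_mono) (auto simp: K_def N_def)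
  qed
  finally have "real V ^ (n - 1) * real V \<le> (K * real A) ^ n * real V"
    using \<open>n > 0\<close> by (metis power_minus_mult)
  then show ?thesis
    using \<open>V > 0\<close> unfolding n_def V_def by simp
qed

section \<open>From cylinders to unit directions near the axes, and the final covering\<close>

lemma cos_ge_quadratic: "1 - x\<^sup>2 / 2 \<le> cos (x :: real)"
proof -
  have "cos x = 1 - 2 * (sin (x / 2))\<^sup>2"
    using cos_double_sin[of "x / 2"] by simp
  moreover have "\<bar>sin (x / 2)\<bar> \<le> \<bar>x / 2\<bar>"
    by (rule abs_sin_x_le_abs_x)
  then have "(sin (x / 2))\<^sup>2 \<le> (x / 2)\<^sup>2"
    by (rule abs_le_square_iff[THEN iffD1])
  ultimately show ?thesis
    by (simp add: power2_eq_square)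
qed

text \<open>The chord between two unit vectors is no longer than the angle between them, because
  \<open>2 - 2 * cos \<theta>\<close> is at most \<open>\<theta>\<^sup>2\<close>.\<close>

lemma line_near_axis:
  fixes L :: "(real ^ 'n::finite) set"
  assumes "is_line L" "line_angle L (coord_axis j) \<le> \<delta>" "0 \<le> \<delta>"
  shows "\<exists>v b. norm v = 1 \<and> norm (v - axis j 1) \<le> \<delta> \<and> L = line b v"
proof -
  obtain u where u: "line_direction L u"
    using assms(1) by (auto simp: is_line_def)
  then obtain b where "u \<noteq> 0" and L: "L = line b u"
    by (auto simp: line_direction_def)
  define e :: "real ^ 'n" where "e = axis j 1"
  have e: "norm e = 1" "e \<noteq> 0"
    by (auto simp: e_def)
  have "line_direction (coord_axis j) e"
    using e by (auto simp: coord_axis_def e_def line_direction_def)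
  \<comment> \<open>This sign turns the direction towards the positive axis, in accordance with the
    absolute value in \<open>line_angle\<close>.\<close>
  define \<sigma> where "\<sigma> = (if 0 \<le> u \<bullet> e then 1 else -1 :: real)"
  define v where "v = (\<sigma> / norm u) *\<^sub>R u"
  have "norm v = 1"
    using \<open>u \<noteq> 0\<close> by (simp add: v_def \<sigma>_def)
  have v_e: "v \<bullet> e = \<bar>u \<bullet> e\<bar> / norm u"
    by (simp add: v_def \<sigma>_def)
  have "0 \<le> v \<bullet> e" "v \<bullet> e \<le> 1"
    using norm_cauchy_schwarz[of v e] \<open>norm v = 1\<close> e by (auto simp: v_e)
  define \<theta> where "\<theta> = line_angle L (coord_axis j)"
  have \<theta>: "\<theta> = arccos (v \<bullet> e)"
    unfolding \<theta>_def line_angle_eq[OF u \<open>line_direction (coord_axis j) e\<close>] using e by (simp add: v_e)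
  then have "0 \<le> \<theta>" "cos \<theta> = v \<bullet> e"
    using \<open>0 \<le> v \<bullet> e\<close> \<open>v \<bullet> e \<le> 1\<close> by (auto intro!: arccos_lbound simp: cos_arccos)
  have "(norm (v - e))\<^sup>2 = 2 - 2 * (v \<bullet> e)"
    using \<open>norm v = 1\<close> e by (simp add: power2_norm_eq_inner algebra_simps inner_commute norm_eq_1)
  also have "\<dots> \<le> \<theta>\<^sup>2"
    using cos_ge_quadratic[of \<theta>] \<open>cos \<theta> = v \<bullet> e\<close> by simp
  also have "\<dots> \<le> \<delta>\<^sup>2"
    using assms(2) \<open>0 \<le> \<theta>\<close> unfolding \<theta>_def by (intro power_mono) auto
  finally have "norm (v - e) \<le> \<delta>"
    using assms(3) by (rule power2_le_imp_le)
  moreover have "L = line b v"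
  proof -
    have "b + t *\<^sub>R u \<in> range (\<lambda>t. b + t *\<^sub>R v)" for t
      using \<open>u \<noteq> 0\<close> by (intro range_eqI[of _ _ "t * norm u * \<sigma>"]) (simp add: v_def \<sigma>_def)
    moreover have "b + t *\<^sub>R v \<in> range (\<lambda>t. b + t *\<^sub>R u)" for t
      by (intro range_eqI[of _ _ "t * (\<sigma> / norm u)"]) (simp add: v_def)
    ultimately show ?thesis
      unfolding L line_def by blast
  qed
  ultimately show ?thesis
    using \<open>norm v = 1\<close> unfolding e_def by blast
qed

lemma mem_cylinder_line:
  fixes x b v :: "'a::euclidean_space"
  assumes "x \<in> cylinder R (line b v)"
  shows "\<exists>s. norm (x - (b + s *\<^sub>R v)) \<le> R"
proof -
  have "closed (line b v)"
  proof -
    have "line b v = (+) b ` range (\<lambda>t. t *\<^sub>R v)"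
      by (auto simp: line_def image_image)
    moreover have "range (\<lambda>t. t *\<^sub>R v) = span {v}"
      by (simp add: span_singleton)
    ultimately show ?thesis
      by (simp add: closed_translation closed_span)
  qed
  moreover have "line b v \<noteq> {}"
    by (simp add: line_def)
  ultimately obtain y where "y \<in> line b v" "infdist x (line b v) = dist x y"
    by (rule infdist_attains_inf)
  then show ?thesis
    using assms by (auto simp: cylinder_def line_def dist_norm)
qed

text \<open>A separated set of largest cardinality exists by the bound, and a point of
  \<open>I\<close> outside all its balls could be added to it.\<close>

lemma exists_maximal_separated:
  fixes I :: "'a::metric_space set"
  assumes bound: "\<And>F. finite F \<Longrightarrow> F \<subseteq> I \<Longrightarrow> (\<forall>p\<in>F. \<forall>q\<in>F. p \<noteq> q \<longrightarrow> r \<le> dist p q) \<Longrightarrow> card F \<le> M"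
    and "0 < r"
  shows "\<exists>F. finite F \<and> card F \<le> M \<and> I \<subseteq> (\<Union>p\<in>F. ball p r)"
proof -
  define sep where "sep F \<longleftrightarrow> finite F \<and> F \<subseteq> I \<and> (\<forall>p\<in>F. \<forall>q\<in>F. p \<noteq> q \<longrightarrow> r \<le> dist p q)" for F
  have "\<exists>F. sep F \<and> (\<forall>F'. sep F' \<longrightarrow> card F' \<le> card F)"
    by (rule ex_has_greatest_nat[of sep "{}" card "Suc M"]) (use bound in \<open>auto simp: sep_def less_Suc_eq_le\<close>)
  then obtain F where F: "sep F" "\<And>F'. sep F' \<Longrightarrow> card F' \<le> card F"
    by blast
  have "I \<subseteq> (\<Union>p\<in>F. ball p r)"
  proof
    fix x assume "x \<in> I"
    show "x \<in> (\<Union>p\<in>F. ball p r)"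
    proof (rule ccontr)
      assume x: "x \<notin> (\<Union>p\<in>F. ball p r)"
      then have "sep (insert x F)" "x \<notin> F"
        using F(1) \<open>x \<in> I\<close> \<open>0 < r\<close> by (auto simp: sep_def dist_commute not_less)
      then show False
        using F(2)[of "insert x F"] F(1) by (simp add: sep_def)
    qed
  qed
  moreover have "finite F" "card F \<le> M"
    using F(1) bound[of F] by (simp_all add: sep_def)
  ultimately show ?thesis
    by blast
qed

theorem theorem1:
  assumes "CARD('n::finite) \<ge> 2"
  shows "\<exists>C::real. \<forall>A::nat. \<forall>L :: 'n \<Rightarrow> nat \<Rightarrow> (real ^ 'n) set.
    A \<ge> 1 \<longrightarrow>
    (\<forall>j. \<forall>a\<in>{1..A}. is_line (L j a) \<and>
        line_angle (L j a) (coord_axis j) \<le> 1 / (100 * real CARD('n))) \<longrightarrow>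
    emeasure lebesgue (\<Inter>j. \<Union>a\<in>{1..A}. cylinder 1 (L j a))
      \<le> ennreal (C * real A powr (real CARD('n) / (real CARD('n) - 1)))"
proof -
  define N where "N = real CARD('n)"
  define K where "K = 8 * N ^ 3 * measure lborel (ball (0 :: real ^ 'n) 2)
    * measure lborel (ball (0 :: real ^ 'n) (9 + 3 * N)) / (measure lborel (ball (0 :: real ^ 'n) 1))\<^sup>2"
  have "K > 0"
    unfolding K_def N_def by (intro divide_pos_pos mult_pos_pos zero_less_power content_ball_pos) auto
  define \<omega> where "\<omega> = measure lborel (ball (0 :: real ^ 'n) (2 * (1 + 3 * N)))"
  define E where "E = N / (N - 1)"
  have N: "N \<ge> 2"
    using assms by (simp add: N_def)
  show ?thesis
  \<comment> \<open>\<open>K powr E\<close> bounds the number of covering balls up to the power of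
    \<open>A\<close>, and \<open>\<omega>\<close> is the volume of each.\<close>
  proof (intro exI[of _ "K powr E * \<omega>"] allI impI)
    fix A :: nat and L :: "'n \<Rightarrow> nat \<Rightarrow> (real ^ 'n) set"
    assume "A \<ge> 1"
      and "\<forall>j. \<forall>a\<in>{1..A}. is_line (L j a) \<and>
        line_angle (L j a) (coord_axis j) \<le> 1 / (100 * real CARD('n))"
    note L = this(2)[folded N_def]
    define I where "I = (\<Inter>j. \<Union>a\<in>{1..A}. cylinder 1 (L j a))"
    \<comment> \<open>A single predicate, with the range of \<open>a\<close> as a premise below,
      lets choice produce \<open>v\<close> and \<open>b\<close> together as functions.\<close>
    define good where "good j a v b \<longleftrightarrow>
      norm v = 1 \<and> norm (v - axis j 1) \<le> 1 / (100 * N) \<and> L j a = line b v" for j a v b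
    have "\<exists>v b. good j a v b" if "a \<in> {1..A}" for j a
      using L N that line_near_axis[of "L j a" j "1 / (100 * N)"] unfolding good_def by auto
    then have "\<forall>j a. \<exists>v b. a \<in> {1..A} \<longrightarrow> good j a v b"
      by blast
    then obtain v b where "\<forall>j a. a \<in> {1..A} \<longrightarrow> good j a (v j a) (b j a)"
      unfolding choice_iff by (elim exE)
    then have v: "norm (v j a) = 1" "norm (v j a - axis j 1) \<le> 1 / (100 * N)" "L j a = line (b j a) (v j a)"
      if "a \<in> {1..A}" for j a
      using that unfolding good_def by blast+
    define M where "M = nat \<lfloor>(K * real A) powr E\<rfloor>"
    have M: "real M \<le> (K * real A) powr E"
      by (simp add: M_def)
    have bound: "card F \<le> M" if F: "finite F" "F \<subseteq> I" "\<forall>p\<in>F. \<forall>q\<in>F. p \<noteq> q \<longrightarrow> 2 * (1 + 3 * N) \<le> dist p q" for F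
    proof -
      have pow: "real (card F) ^ (CARD('n) - 1) \<le> (K * real A) ^ CARD('n)"
        unfolding K_def N_def
      proof (rule separated_card_bound[where v=v and b=b])
        show "\<exists>a\<in>{1..A}. \<exists>s. norm (p - (b j a + s *\<^sub>R v j a)) \<le> 1" if "p \<in> F" for p j
        proof -
          have "p \<in> (\<Union>a\<in>{1..A}. cylinder 1 (L j a))"
            using that F(2) by (auto simp: I_def)
          then obtain a where "a \<in> {1..A}" "p \<in> cylinder 1 (line (b j a) (v j a))"
            using v(3) by auto
          then show ?thesis
            using mem_cylinder_line by blast
        qed
      qed (use F v assms in \<open>auto simp: N_def\<close>)
      have "real (CARD('n) - 1) = N - 1"
        using assms by (simp add: N_def of_nat_diff)
      have le: "real (card F) powr (N - 1) \<le> (K * real A) powr N"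
      proof (cases "card F = 0")
        case False
        have "(K * real A) powr N = (K * real A) ^ CARD('n)"
          unfolding N_def using \<open>K > 0\<close> \<open>A \<ge> 1\<close> by (intro powr_realpow) simp
        moreover have "real (card F) powr (N - 1) = real (card F) ^ (CARD('n) - 1)"
          unfolding \<open>real (CARD('n) - 1) = N - 1\<close>[symmetric] using False by (intro powr_realpow) simp
        ultimately show ?thesis
          using pow by simp
      qed simp
      have "real (card F) = (real (card F) powr (N - 1)) powr (1 / (N - 1))"
        using N by (simp add: powr_powr)
      also have "\<dots> \<le> ((K * real A) powr N) powr (1 / (N - 1))"
        using le N by (intro powr_mono2) auto
      also have "\<dots> = (K * real A) powr E"
        by (simp add: powr_powr E_def)
      finally show ?thesis
        by (simp add: M_def le_nat_floor)
    qed
    obtain F where F: "finite F" "card F \<le> M" "I \<subseteq> (\<Union>p\<in>F. ball p (2 * (1 + 3 * N)))"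
      using exists_maximal_separated[of I "2 * (1 + 3 * N)" M, OF bound] N by auto
    have "emeasure lebesgue I \<le> emeasure lebesgue (\<Union>p\<in>F. ball p (2 * (1 + 3 * N)))"
      using F(3) by (intro emeasure_mono) (auto intro!: sets.finite_UN F(1))
    also have "\<dots> \<le> (\<Sum>p\<in>F. emeasure lebesgue (ball p (2 * (1 + 3 * N))))"
      using F(1) by (intro emeasure_subadditive_finite) auto
    also have "\<dots> = (\<Sum>p\<in>F. ennreal \<omega>)"
    proof (rule sum.cong[OF refl])
      fix p :: "real ^ 'n"
      have "emeasure lebesgue (ball p (2 * (1 + 3 * N))) = ennreal (measure lborel (ball p (2 * (1 + 3 * N))))"
        using emeasure_lborel_ball_finite[of p "2 * (1 + 3 * N)"] by (simp add: emeasure_eq_ennreal_measure)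
      also have "measure lborel (ball p (2 * (1 + 3 * N))) = \<omega>"
        using N by (simp add: \<omega>_def content_ball)
      finally show "emeasure lebesgue (ball p (2 * (1 + 3 * N))) = ennreal \<omega>" .
    qed
    also have "\<dots> = ennreal (real (card F) * \<omega>)"
      by (simp add: ennreal_mult ennreal_of_nat_eq_real_of_nat \<omega>_def)
    also have "\<dots> \<le> ennreal (K powr E * \<omega> * real A powr E)"
    proof (rule ennreal_leI)
      have "real (card F) \<le> K powr E * real A powr E"
        using F(2) M \<open>K > 0\<close> by (simp add: powr_mult)
      then show "real (card F) * \<omega> \<le> K powr E * \<omega> * real A powr E"
        using mult_right_mono[of _ _ \<omega>] by (fastforce simp: \<omega>_def mult_ac)
    qed
    finally show "emeasure lebesgue (\<Inter>j. \<Union>a\<in>{1..A}. cylinder 1 (L j a))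
        \<le> ennreal (K powr E * \<omega> * real A powr (real CARD('n) / (real CARD('n) - 1)))"
      unfolding I_def E_def N_def .
  qed
qed

end
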